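(* Let $\mu_\omega$, $\omega\in\Omega$, be the random Moran measures described in the context, and assume that there exists $A_0>0$ such that $\mathbb{E}(e^{\lambda Z_1})<\infty$ for all $|\lambda|\le A_0$. Put $$\alpha=\operatorname{ess\,sup}\frac{\log m_1}{\log r_1}\in[0,\infty],\qquad \beta=\operatorname{ess\,inf}\frac{\log M_1}{\log r_1}.$$ Then there is a set $\Gamma\subseteq\Omega$ of full $\mathbb{P}$-measure with the following properties: (i) $\underline{\dim}_\Phi\,\mu_\omega\le\beta$ and $\overline{\dim}_\Phi\,\mu_\omega\ge\alpha$ for all small dimension functions $\Phi$ and all $\omega\in\Gamma$. (ii) If either $\operatorname{ess\,inf}M_1>0$ or $\operatorname{ess\,inf}r_1>0$, then $\underline{\dim}_\Phi\,\mu_\omega\ge\beta$ for all dimension functions $\Phi$ and all $\omega\in\Gamma$. (iii) If either $\operatorname{ess\,inf}m_1>0$ or $\operatorname{ess\,inf}r_1>0$, then $\overline{\dim}_\Phi\,\mu_\omega\le\alpha$ for all dimension functions $\Phi$ and all $\omega\in\Gamma$.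
   Context: **Random Moran sets and measures.** Fix a compact set $I_0\subseteq\mathbb{R}^D$ with diameter $1$ and non-empty interior, and fix $0<\tau<1$. For a set $I$ and $r>0$, a subset $J\subseteq I$ is an $r$-similarity of $I$ if $J=S(I)$ for some similarity $S$ with $\mathrm{diam}(J)=r\,\mathrm{diam}(I)$. A collection $J_1,\dots,J_t$ of $r$-similarities of $I$ is $\tau$-separated if $d(J_i,J_j)\ge\tau\, r\,\mathrm{diam}(I)$ for all $i\ne j$. For each $t\in\mathbb{N}$ fix $\rho_t\in(0,1/2]$ such that for every $0<r\le\rho_t$ there is a $\tau$-separated collection of $t$ $r$-similarities of $I_0$. For $t\ge2$ let $\mathcal{S}_t=\{(x_1,\dots,x_t)\in\mathbb{R}^t: x_i>0,\ \sum_i x_i=1\}$, $\Omega_t=(0,\rho_t]\times\mathcal{S}_t$, and $\Omega_0=\bigcup_{t\ge2}\Omega_t$ (disjoint union). Let $\pi$ be a Borel probability measure on $\Omega_0$ and let $\mathbb{P}$ be the product measure induced by $\pi$ on $\Omega=\Omega_0^{\mathbb{N}}$. For $\omega\in\Omega$, the $n$-th coordinate is an element of some $\Omega_t$ and is written $(r_n,p_n^{(1)},\dots,p_n^{(t)})$; put $T_n=t$. Thus $(T_n,r_n,p_n)$, $n\ge1$, are iid. Given $\omega$, start with $I_0$ as the only Moran set of step $0$; from each Moran set $I$ of step $n$ select $T_{n+1}(\omega)$ subsets (the children of $I$) that are $r_{n+1}(\omega)$-similarities of $I$ and are $\tau$-separated (any such selection). All the children so obtained are the Moran sets of step $n+1$;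 they have diameter $r_1\cdots r_{n+1}$. The random Moran set $E(\omega)$ is the intersection over $n$ of the union of all step $n$ Moran sets. The random Moran measure $\mu_\omega$ is the Borel probability measure supported on $E(\omega)$ with $\mu_\omega(I_0)=1$ and $\mu_\omega(I^{(j)})=\mu_\omega(I)\,p_{n+1}^{(j)}$ whenever $I^{(1)},\dots,I^{(T_{n+1})}$ are the (labelled) children of the step $n$ Moran set $I$. Put $M_n=\max_j p_n^{(j)}$, $m_n=\min_j p_n^{(j)}$, $Z_n=-\log r_n$. Essential suprema and infima are with respect to $\mathbb{P}$. **$\Phi$-dimensions.** A dimension function is a map $\Phi:(0,1)\to[0,\infty)$ such that $x^{1+\Phi(x)}$ decreases to $0$ as $x$ decreases to $0$. For a Borel probability measure $\mu$, with $B(x,R)$ the open ball, $\overline{\dim}_\Phi\mu$ is the infimum of all $d$ for which there are $C_1,C_2>0$ such that for all $0<r<R^{1+\Phi(R)}\le R\le C_1$ and all $x\in\mathrm{supp}\,\mu$, $\frac{\mu(B(x,R))}{\mu(B(x,r))}\le C_2\left(\frac Rr\right)^d$ (and $\infty$ if there is no such $d$); and $\underline{\dim}_\Phi\mu$ is the supremum of all $d$ for which there are $C_1,C_2>0$ such that for all $0<r<R^{1+\Phi(R)}\le R\le C_1$ and all $x\in\mathrm{supp}\,\mu$, $\frac{\mu(B(x,R))}{\mu(B(x,r))}\ge C_2\left(\frac Rr\right)^d$. A dimension function $\Phi$ is *small* if there are a function $A(x)$ with $A(x)\to\infty$ as $x\to0^+$ and $\delta>0$ such that $\frac{\log|\log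 x|}{|\log x|}\ge A(x)\,\Phi(x)$ for all $0<x<\delta$. *)

theory Defs
  imports "HOL-Probability.Probability"
begin

text \<open>
  An element (r, x_1, ..., x_t) of the t-th summand of the disjoint union \<open>\<Omega>\<^sub>0\<close> is encoded as
  (t, r, p), where the weights are \<open>p 0, ..., p (t - 1)\<close> and \<open>p\<close> vanishes from \<open>t\<close> on.
  With the discrete topology on nat and the product topology on nat => real, the subspace topology
  on \<open>Omega0\<close> is the disjoint union topology, so its Borel sets are those of
  \<open>restrict_space borel Omega0\<close>.
\<close>

type_synonym moran_param = "nat \<times> real \<times> (nat \<Rightarrow> real)"

definition open_simplex :: "nat \<Rightarrow> (nat \<Rightarrow> real) set" where
  "open_simplex t = {p. (\<forall>j<t. 0 < p j) \<and> (\<forall>j\<ge>t. p j = 0) \<and> (\<Sum>j<t. p j) = 1}"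

definition Omega0 :: "(nat \<Rightarrow> real) \<Rightarrow> moran_param set" where
  "Omega0 \<rho> = (\<Union>t\<in>{2..}. {t} \<times> {0<..\<rho> t} \<times> open_simplex t)"

definition children_count :: "moran_param \<Rightarrow> nat" where
  "children_count a = fst a"

definition ratio :: "moran_param \<Rightarrow> real" where
  "ratio a = fst (snd a)"

definition weight :: "moran_param \<Rightarrow> nat \<Rightarrow> real" where
  "weight a = snd (snd a)"

definition max_weight :: "moran_param \<Rightarrow> real" where
  "max_weight a = Max (weight a ` {..<children_count a})"

definition min_weight :: "moran_param \<Rightarrow> real" where
  "min_weight a = Min (weight a ` {..<children_count a})"

definition similarity :: "('a::metric_space \<Rightarrow> 'a) \<Rightarrow> bool" where
  "similarity S \<longleftrightarrow> (\<exists>c>0. \<forall>x y. dist (S x) (S y) = c * dist x y)"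

definition r_similarity :: "real \<Rightarrow> 'a::metric_space set \<Rightarrow> 'a set \<Rightarrow> bool" where
  "r_similarity r I J \<longleftrightarrow>
     J \<subseteq> I \<and> (\<exists>S. similarity S \<and> J = S ` I) \<and> diameter J = r * diameter I"

definition separated_similarities ::
    "real \<Rightarrow> real \<Rightarrow> 'a::metric_space set \<Rightarrow> nat \<Rightarrow> (nat \<Rightarrow> 'a set) \<Rightarrow> bool" where
  "separated_similarities \<tau> r I t J \<longleftrightarrow>
     (\<forall>j<t. r_similarity r I (J j)) \<and>
     (\<forall>i<t. \<forall>j<t. i \<noteq> j \<longrightarrow> setdist (J i) (J j) \<ge> \<tau> * r * diameter I)"

text \<open>
  Coordinates of \<open>\<omega>\<close> are numbered from 0, so \<open>\<omega> n\<close> is the (n+1)-st coordinate and governs the passage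
  from step n to step n + 1. Moran sets are indexed by words: the j-th child of the Moran set with
  word \<open>w\<close> has word \<open>w @ [j]\<close>.
\<close>

definition moran_words :: "(nat \<Rightarrow> moran_param) \<Rightarrow> nat \<Rightarrow> nat list set" where
  "moran_words \<omega> n = {w. length w = n \<and> (\<forall>k<n. w ! k < children_count (\<omega> k))}"

definition moran_construction ::
    "real \<Rightarrow> 'a::metric_space set \<Rightarrow> (nat \<Rightarrow> moran_param) \<Rightarrow> (nat list \<Rightarrow> 'a set) \<Rightarrow> bool" where
  "moran_construction \<tau> I0 \<omega> I \<longleftrightarrow>
     I [] = I0 \<and>
     (\<forall>n. \<forall>w\<in>moran_words \<omega> n.
        separated_similarities \<tau> (ratio (\<omega> n)) (I w) (children_count (\<omega> n)) (\<lambda>j. I (w @ [j])))"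

definition moran_set :: "(nat \<Rightarrow> moran_param) \<Rightarrow> (nat list \<Rightarrow> 'a set) \<Rightarrow> 'a set" where
  "moran_set \<omega> I = (\<Inter>n. \<Union>w\<in>moran_words \<omega> n. I w)"

definition moran_measure ::
    "(nat \<Rightarrow> moran_param) \<Rightarrow> (nat list \<Rightarrow> 'a::topological_space set) \<Rightarrow> 'a measure \<Rightarrow> bool" where
  "moran_measure \<omega> I \<mu> \<longleftrightarrow>
     sets \<mu> = sets borel \<and> prob_space \<mu> \<and>
     (AE x in \<mu>. x \<in> moran_set \<omega> I) \<and>
     measure \<mu> (I []) = 1 \<and>
     (\<forall>n. \<forall>w\<in>moran_words \<omega> n. \<forall>j<children_count (\<omega> n).
        measure \<mu> (I (w @ [j])) = measure \<mu> (I w) * weight (\<omega> n) j)"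

definition dimension_function :: "(real \<Rightarrow> real) \<Rightarrow> bool" where
  "dimension_function \<Phi> \<longleftrightarrow>
     (\<forall>x\<in>{0<..<1}. 0 \<le> \<Phi> x) \<and>
     mono_on {0<..<1} (\<lambda>x. x powr (1 + \<Phi> x)) \<and>
     ((\<lambda>x. x powr (1 + \<Phi> x)) \<longlongrightarrow> 0) (at_right 0)"

text \<open>
  Dimension functions live on (0,1); values of \<open>\<Phi>\<close> elsewhere are arbitrary, which is why the
  scales below carry an explicit bound by 1.
\<close>

definition small_dimension_function :: "(real \<Rightarrow> real) \<Rightarrow> bool" where
  "small_dimension_function \<Phi> \<longleftrightarrow>
     dimension_function \<Phi> \<and>
     (\<exists>A \<delta>. filterlim A at_top (at_right 0) \<and> 0 < \<delta> \<and>
        (\<forall>x. 0 < x \<and> x < \<delta> \<and> x < 1 \<longrightarrow> ln \<bar>ln x\<bar> / \<bar>ln x\<bar> \<ge> A x * \<Phi> x))"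

definition measure_support :: "'a::topological_space measure \<Rightarrow> 'a set" where
  "measure_support \<mu> = {x. \<forall>U. open U \<and> x \<in> U \<longrightarrow> emeasure \<mu> U > 0}"

definition phi_scales :: "(real \<Rightarrow> real) \<Rightarrow> real \<Rightarrow> (real \<times> real) set" where
  "phi_scales \<Phi> C = {(r, R). 0 < r \<and> r < R powr (1 + \<Phi> R) \<and> R powr (1 + \<Phi> R) \<le> R
     \<and> R \<le> C \<and> 0 < R \<and> R < 1}"

definition upper_phi_dim :: "(real \<Rightarrow> real) \<Rightarrow> 'a::metric_space measure \<Rightarrow> ereal" where
  "upper_phi_dim \<Phi> \<mu> = Inf {ereal d | d. \<exists>C1>0. \<exists>C2>0.
     \<forall>(r, R)\<in>phi_scales \<Phi> C1. \<forall>x\<in>measure_support \<mu>.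
       measure \<mu> (ball x R) / measure \<mu> (ball x r) \<le> C2 * (R / r) powr d}"

definition lower_phi_dim :: "(real \<Rightarrow> real) \<Rightarrow> 'a::metric_space measure \<Rightarrow> ereal" where
  "lower_phi_dim \<Phi> \<mu> = Sup {ereal d | d. \<exists>C1>0. \<exists>C2>0.
     \<forall>(r, R)\<in>phi_scales \<Phi> C1. \<forall>x\<in>measure_support \<mu>.
       measure \<mu> (ball x R) / measure \<mu> (ball x r) \<ge> C2 * (R / r) powr d}"

definition essinf :: "'b measure \<Rightarrow> ('b \<Rightarrow> ereal) \<Rightarrow> ereal" where
  "essinf M f = - esssup M (\<lambda>x. - f x)"

end

theory Submission
  imports Defs
begin

text \<open>
  Moran sets of the same step n are at distance at least \<open>\<tau>\<close> times their diameter D n, so up to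
  constants \<open>\<mu> (ball x R)\<close> is the mass of the step n Moran set around x when R is comparable to D n,
  and ratios of ball masses are products of inverse weights between two steps. These products lie
  between powers of quotients of the D n as soon as every weight lies between \<open>r ^ \<alpha>\<close> and \<open>r ^ \<beta>\<close>,
  which yields (ii) and (iii); the lower bound on the ratios or the weights absorbs the steps in which
  R and r fall between two consecutive diameters.

  For (i), fix a < \<open>\<alpha>\<close>. Almost surely, for every large L there is a window of L consecutive steps,
  starting at a step exponential in L, in which \<open>min_weight \<le> ratio powr a\<close> throughout. Following the
  child of least weight gives a point at which the mass ratio across the window is at least the a-th
  power of the diameter ratio. Since log |log (D n)| is linear in L, a small dimension function admits
  the scales at the two ends of the window. The argument for \<open>\<beta>\<close> uses the child of largest weight.
\<close>

section \<open>Weights and ratios\<close>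

lemma Omega0_cases:
  assumes "a \<in> Omega0 \<rho>"
  shows "2 \<le> children_count a" "0 < ratio a" "ratio a \<le> \<rho> (children_count a)"
    and "weight a \<in> open_simplex (children_count a)"
  using assms by (auto simp: Omega0_def children_count_def ratio_def weight_def)

lemma Omega0_weight_pos:
  assumes "a \<in> Omega0 \<rho>" "j < children_count a"
  shows "0 < weight a j"
  using Omega0_cases(4)[OF assms(1)] assms(2) by (simp add: open_simplex_def)

lemma Omega0_weight_less_1:
  assumes "a \<in> Omega0 \<rho>" "j < children_count a"
  shows "weight a j < 1"
proof -
  have sum1: "(\<Sum>i<children_count a. weight a i) = 1"
    using Omega0_cases(4)[OF assms(1)] by (simp add: open_simplex_def)
  obtain i where i: "i < children_count a" "i \<noteq> j"
    using Omega0_cases(1)[OF assms(1)] by (metis less_le_trans one_less_numeral_iff pos2 semiring_norm(76) zero_neq_one)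
  have "(\<Sum>k\<in>{i, j}. weight a k) \<le> (\<Sum>k<children_count a. weight a k)"
    using i assms by (intro sum_mono2) (auto intro: less_imp_le Omega0_weight_pos[OF assms(1)])
  with i sum1 Omega0_weight_pos[OF assms(1) i(1)] show ?thesis by simp
qed

lemma min_weight_attained:
  assumes "a \<in> Omega0 \<rho>"
  obtains j where "j < children_count a" "weight a j = min_weight a"
proof -
  have "min_weight a \<in> weight a ` {..<children_count a}"
    unfolding min_weight_def using Omega0_cases(1)[OF assms] by (intro Min_in) (auto simp: lessThan_empty_iff)
  then show ?thesis using that by auto
qed

lemma max_weight_attained:
  assumes "a \<in> Omega0 \<rho>"
  obtains j where "j < children_count a" "weight a j = max_weight a"
proof -
  have "max_weight a \<in> weight a ` {..<children_count a}"
    unfolding max_weight_def using Omega0_cases(1)[OF assms] by (intro Max_in) (auto simp: lessThan_empty_iff)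
  then show ?thesis using that by auto
qed

lemma min_weight_le: "j < children_count a \<Longrightarrow> min_weight a \<le> weight a j"
  unfolding min_weight_def by (intro Min_le) auto

lemma max_weight_ge: "j < children_count a \<Longrightarrow> weight a j \<le> max_weight a"
  unfolding max_weight_def by (intro Max_ge) auto

lemma min_weight_bounds:
  assumes "a \<in> Omega0 \<rho>"
  shows "0 < min_weight a" "min_weight a < 1"
  using min_weight_attained[OF assms] Omega0_weight_pos[OF assms] Omega0_weight_less_1[OF assms]
  by metis+

lemma max_weight_bounds:
  assumes "a \<in> Omega0 \<rho>"
  shows "0 < max_weight a" "max_weight a < 1"
  using max_weight_attained[OF assms] Omega0_weight_pos[OF assms] Omega0_weight_less_1[OF assms]
  by metis+

text \<open>Since \<open>ln r\<close> is negative, multiplying by it reverses inequalities. The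
  bounds by \<alpha> and \<beta> thereby become comparisons of a weight with a power of the ratio,
  and such comparisons multiply along words.\<close>

lemma log_quotient_le_iff:
  fixes r v a :: real
  assumes "0 < r" "r < 1" "0 < v"
  shows "ln v / ln r \<le> a \<longleftrightarrow> r powr a \<le> v" "a \<le> ln v / ln r \<longleftrightarrow> v \<le> r powr a"
proof -
  have r: "ln r < 0" using assms by simp
  have "ln v / ln r \<le> a \<longleftrightarrow> a * ln r \<le> ln v" using r by (simp add: divide_le_eq)
  also have "\<dots> \<longleftrightarrow> ln (r powr a) \<le> ln v" using assms by (simp add: ln_powr)
  also have "\<dots> \<longleftrightarrow> r powr a \<le> v" using assms by (subst ln_le_cancel_iff) auto
  finally show "ln v / ln r \<le> a \<longleftrightarrow> r powr a \<le> v" .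
  have "a \<le> ln v / ln r \<longleftrightarrow> ln v \<le> a * ln r" using r by (simp add: le_divide_eq)
  also have "\<dots> \<longleftrightarrow> ln v \<le> ln (r powr a)" using assms by (simp add: ln_powr)
  also have "\<dots> \<longleftrightarrow> v \<le> r powr a" using assms by (subst ln_le_cancel_iff) auto
  finally show "a \<le> ln v / ln r \<longleftrightarrow> v \<le> r powr a" .
qed

text \<open>Rational intermediate exponents leave only countably many almost sure events to
  intersect.\<close>

lemma rat_dense_ereal:
  fixes x y :: ereal
  assumes "x < y"
  obtains q :: rat where "x < ereal (of_rat q)" "ereal (of_rat q) < y"
proof -
  obtain u where u: "x < ereal u" "ereal u < y" using ereal_dense2[OF assms] by blast
  obtain v where v: "ereal u < ereal v" "ereal v < y" using ereal_dense2[OF u(2)] by blast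
  obtain q where "u < of_rat q" "of_rat q < v" using of_rat_dense[of u v] v(1) by auto
  with u v that[of q] show ?thesis by (meson less_ereal.simps(1) less_trans)
qed

section \<open>Admissible scales of small dimension functions\<close>

lemma phi_scalesD:
  assumes "(s, R) \<in> phi_scales \<Phi> C"
  shows "0 < s" "s < R" "R \<le> C" "R < 1"
  using assms by (auto simp: phi_scales_def)

text \<open>This absorbs all multiplicative constants: over a window of length L the diameter
  changes by a factor of at least 2^L.\<close>

lemma eventually_powr_gt:
  fixes e K :: real
  assumes "0 < e"
  shows "\<forall>\<^sub>F L in sequentially. K < (2 ^ L) powr e"
proof -
  have "1 < (2::real) powr e" using assms by simp
  then obtain n where n: "K < (2 powr e) ^ n" using real_arch_pow by blast
  have "\<forall>\<^sub>F L in sequentially. K < (2 powr e) ^ L"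
  proof (rule eventually_sequentiallyI[of n])
    fix L assume "n \<le> L"
    with \<open>1 < 2 powr e\<close> have "(2 powr e) ^ n \<le> (2 powr e) ^ L" by (intro power_increasing) auto
    with n show "K < (2 powr e) ^ L" by simp
  qed
  then show ?thesis
    by (simp add: powr_realpow[symmetric] powr_powr mult.commute)
qed

text \<open>
  For a small dimension function, R/r > exp (log |log R| / A(R)) suffices for (r, R) to be
  admissible, while between steps n and n + L the diameter shrinks at least by the factor 2^L. As |log R| is at most
  exponential in L when n is, windows of length L contain admissible scales.
\<close>

lemma small_dimension_function_scales:
  fixes D :: "nat \<Rightarrow> real" and c c' C H :: real and B :: nat
  assumes small: "small_dimension_function \<Phi>"
    and D_pos: "\<And>n. 0 < D n" and D_le: "\<And>n. D n \<le> 1 / 2 ^ n"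
    and D_drop: "\<And>n k. n \<le> k \<Longrightarrow> D k \<le> D n / 2 ^ (k - n)"
    and growth: "\<And>n. - ln (D n) \<le> H * (real n + 1) ^ 3"
    and pos: "0 < c" "0 < c'" "0 < C" "0 < B"
  shows "\<forall>\<^sub>F L in sequentially. \<forall>n k. L \<le> n \<longrightarrow> n \<le> L * (L * B ^ L) \<longrightarrow> n + L \<le> k \<longrightarrow>
    (c' * D k, c * D n) \<in> phi_scales \<Phi> C"
proof -
  \<comment> \<open>\<open>K ^ L\<close> will dominate |ln R|: n is at most (4B)^L, so the cubic
    growth bound contributes a multiple of (64 B^3)^L, and 2^L absorbs the constants.\<close>
  define K :: real where "K = 128 * real B ^ 3"
  have "1 \<le> real B" using pos(4) by simp
  then have "1 \<le> real B ^ 3" by (rule one_le_power)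
  then have K: "128 \<le> K" by (simp add: K_def)
  \<comment> \<open>Calibrated so that \<open>A1 * (\<Phi> R * y) \<le> real L * ln K\<close>, where
    y = |ln R|, becomes \<Phi>(R) y \<le> L ln 2 / 2. The exponent \<Phi> then uses up at most half
    of the guaranteed decay, on a logarithmic scale.\<close>
  define A1 where "A1 = 2 * ln K / ln 2"
  have A1_pos: "0 < A1" using K by (simp add: A1_def)
  obtain A \<delta> where A: "filterlim A at_top (at_right 0)" "0 < \<delta>"
      "\<And>x. 0 < x \<Longrightarrow> x < \<delta> \<Longrightarrow> x < 1 \<Longrightarrow> A x * \<Phi> x \<le> ln \<bar>ln x\<bar> / \<bar>ln x\<bar>"
    using small by (auto simp: small_dimension_function_def)
  have "\<forall>\<^sub>F x in at_right 0. A1 \<le> A x"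
    using A(1) by (simp add: filterlim_at_top)
  then obtain b where b: "0 < b" "\<And>x. 0 < x \<Longrightarrow> x < b \<Longrightarrow> A1 \<le> A x"
    by (auto simp: eventually_at_right_field)
  \<comment> \<open>Below \<open>e\<close> all smallness conditions on R hold at once; the entry
    \<open>exp (-1)\<close> makes |ln R| = - ln R exceed 1.\<close>
  define e where "e = Min {b, \<delta>, C, exp (-1)}"
  have e: "0 < e" "e \<le> b" "e \<le> \<delta>" "e \<le> C" "e \<le> exp (-1)"
    using b A(2) pos(3) by (auto simp: e_def)
  have "\<forall>\<^sub>F L in sequentially. c / e < (2 ^ L) powr 1"
    by (intro eventually_powr_gt) simp
  moreover have "\<forall>\<^sub>F L in sequentially. \<bar>ln c\<bar> + 8 * \<bar>H\<bar> < (2 ^ L) powr 1"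
    by (intro eventually_powr_gt) simp
  moreover have "\<forall>\<^sub>F L in sequentially. c' / c < (2 ^ L) powr (1/2)"
    by (intro eventually_powr_gt) simp
  ultimately show ?thesis
  \<comment> \<open>The three thresholds on L put R below \<open>e\<close>, absorb \<open>c\<close>
    and \<open>H\<close> in the bound for |ln R|, and let the factor 2^(L/2) left over by \<Phi>
    cover c'/c.\<close>
  proof eventually_elim
    case (elim L)
    show ?case
    proof (intro allI impI)
      fix n k assume n: "L \<le> n" "n \<le> L * (L * B ^ L)" and k: "n + L \<le> k"
      define R where "R = c * D n"
      have R_pos: "0 < R" using pos D_pos by (simp add: R_def)
      have "R \<le> c * (1 / 2 ^ n)"
        unfolding R_def using pos D_le by (intro mult_left_mono) auto
      also have "\<dots> \<le> c * (1 / 2 ^ L)"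
        using pos n by (intro mult_left_mono divide_left_mono) (auto intro: power_increasing)
      also have "\<dots> < e"
        using elim(1) e(1) by (simp add: field_simps)
      finally have "R < e" .
      with e have R: "R < b" "R < \<delta>" "R < C" "R < exp (-1)" by linarith+
      have "exp (-1) < (1::real)" by simp
      with R have R1: "R < 1" by linarith
      define y where "y = - ln R"
      have "ln R < ln (exp (-1))" using R(4) R_pos by (subst ln_less_cancel_iff) auto
      then have y: "1 < y" by (simp add: y_def)
      have abs_y: "\<bar>ln R\<bar> = y" using y by (simp add: y_def)
      have ln_y: "ln y \<le> real L * ln K"
      proof -
        have L2: "real L \<le> 2 ^ L" by (metis less_exp less_imp_le of_nat_le_iff of_nat_numeral of_nat_power)
        have "1 \<le> (4 * real B) ^ L" using \<open>1 \<le> real B\<close> by (intro one_le_power) simp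
        have "real n \<le> real L * (real L * real B ^ L)"
          using n(2) by (metis of_nat_le_iff of_nat_mult of_nat_power)
        also have "\<dots> \<le> 2 ^ L * (2 ^ L * real B ^ L)"
          using L2 by (intro mult_mono) auto
        also have "\<dots> = (4 * real B) ^ L"
          using power_mult_distrib[of "2::real" 2 L] power_mult_distrib[of 4 "real B" L] by simp
        finally have "real n + 1 \<le> 2 * (4 * real B) ^ L"
          using \<open>1 \<le> (4 * real B) ^ L\<close> by simp
        then have "(real n + 1) ^ 3 \<le> (2 * (4 * real B) ^ L) ^ 3"
          by (intro power_mono) auto
        also have "\<dots> = 8 * (64 * real B ^ 3) ^ L"
        proof -
          have "((4 * real B) ^ L) ^ 3 = ((4 * real B) ^ 3) ^ L"
            by (metis mult.commute power_mult)
          then show ?thesis by (simp add: power_mult_distrib[of 2] power_mult_distrib[of 4])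
        qed
        finally have n3: "(real n + 1) ^ 3 \<le> 8 * (64 * real B ^ 3) ^ L" .
        have "y = - ln c + - ln (D n)"
          using pos(1) D_pos[of n] by (simp add: y_def R_def ln_mult)
        also have "\<dots> \<le> \<bar>ln c\<bar> + \<bar>H\<bar> * (8 * (64 * real B ^ 3) ^ L)"
        proof (intro add_mono)
          have "- ln (D n) \<le> H * (real n + 1) ^ 3" by (rule growth)
          also have "\<dots> \<le> \<bar>H\<bar> * (real n + 1) ^ 3" by (intro mult_right_mono) auto
          also have "\<dots> \<le> \<bar>H\<bar> * (8 * (64 * real B ^ 3) ^ L)" by (intro mult_left_mono n3) auto
          finally show "- ln (D n) \<le> \<dots>" .
        qed simp
        also have "\<dots> \<le> \<bar>ln c\<bar> * (64 * real B ^ 3) ^ L + \<bar>H\<bar> * (8 * (64 * real B ^ 3) ^ L)"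
        proof -
          have "1 \<le> (64 * real B ^ 3) ^ L"
            using \<open>1 \<le> real B ^ 3\<close> by (intro one_le_power) simp
          then have "\<bar>ln c\<bar> * 1 \<le> \<bar>ln c\<bar> * (64 * real B ^ 3) ^ L" by (intro mult_left_mono) auto
          then show ?thesis by simp
        qed
        also have "\<dots> = (\<bar>ln c\<bar> + 8 * \<bar>H\<bar>) * (64 * real B ^ 3) ^ L" by (simp add: algebra_simps)
        also have "\<dots> \<le> 2 ^ L * (64 * real B ^ 3) ^ L"
          using elim(2) by (intro mult_right_mono) auto
        also have "\<dots> = K ^ L"
          using power_mult_distrib[of "2::real" 64 L, symmetric] by (simp add: K_def power_mult_distrib)
        finally have "ln y \<le> ln (K ^ L)" using y K by (subst ln_le_cancel_iff) auto
        then show ?thesis using K by (simp add: ln_realpow)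
      qed
      have \<Phi>: "0 \<le> \<Phi> R"
        using small R_pos R1 by (auto simp: small_dimension_function_def dimension_function_def)
      have "A1 * \<Phi> R \<le> A R * \<Phi> R"
        using b(2)[OF R_pos R(1)] \<Phi> by (rule mult_right_mono)
      also have "\<dots> \<le> ln y / y"
        using A(3)[OF R_pos R(2) R1] by (simp add: abs_y)
      finally have "A1 * (\<Phi> R * y) \<le> ln y" using y by (simp add: field_simps)
      also have "\<dots> \<le> real L * ln K" by (rule ln_y)
      also have "\<dots> = A1 * (real L * ln 2 / 2)" by (simp add: A1_def)
      finally have "A1 * (\<Phi> R * y) \<le> A1 * (real L * ln 2 / 2)" .
      then have \<Phi>y: "\<Phi> R * y \<le> real L * ln 2 / 2" using A1_pos by simp
      have power: "R powr (1 + \<Phi> R) = R * exp (- (\<Phi> R * y))"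
        using R_pos by (simp add: powr_add) (simp add: powr_def y_def)
      have half: "exp (- (real L * ln 2 / 2)) = (2 ^ L) powr (1/2) / 2 ^ L"
      proof -
        have "exp (- (real L * ln 2 / 2)) = exp (real L * ln 2 / 2) / exp (real L * ln 2)"
          by (simp add: exp_diff[symmetric])
        also have "exp (real L * ln 2) = 2 ^ L" by (simp add: exp_of_nat_mult)
        also have "exp (real L * ln 2 / 2) = (2 ^ L) powr (1/2)"
          by (simp add: powr_def ln_realpow)
        finally show ?thesis .
      qed
      have "c' * D k \<le> c' * (D n / 2 ^ L)"
      proof (rule mult_left_mono)
        have "D k \<le> D n / 2 ^ (k - n)" using k by (intro D_drop) simp
        also have "\<dots> \<le> D n / 2 ^ L"
          using k D_pos[of n] by (intro divide_left_mono) (auto intro: power_increasing)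
        finally show "D k \<le> D n / 2 ^ L" .
      qed (use pos in simp)
      also have "\<dots> = R * ((c' / c) / 2 ^ L)" using pos by (simp add: R_def)
      also have "\<dots> < R * ((2 ^ L) powr (1/2) / 2 ^ L)"
        using elim(3) R_pos by (intro mult_strict_left_mono divide_strict_right_mono) auto
      also have "\<dots> \<le> R powr (1 + \<Phi> R)"
        unfolding power half[symmetric] using \<Phi>y R_pos by simp
      finally have "c' * D k < R powr (1 + \<Phi> R)" .
      moreover have "R powr (1 + \<Phi> R) \<le> R"
        unfolding power using \<Phi> y R_pos by (simp add: mult_left_le)
      ultimately show "(c' * D k, c * D n) \<in> phi_scales \<Phi> C"
        using R R1 R_pos pos D_pos by (simp add: phi_scales_def flip: R_def)
    qed
  qed
qed

section \<open>Geometry of a realisation\<close>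

text \<open>The common diameter of the step n Moran sets, because \<open>I0\<close> has diameter 1
  and all sets of a step shrink by the same ratio.\<close>

definition diam_prod :: "(nat \<Rightarrow> moran_param) \<Rightarrow> nat \<Rightarrow> real" where
  "diam_prod \<omega> n = (\<Prod>k<n. ratio (\<omega> k))"

text \<open>A single outcome: geometry and dimension bounds are deterministic, and randomness will
  enter only through the conditions satisfied by the coordinates.\<close>

locale moran_realisation =
  fixes \<tau> :: real and \<rho> :: "nat \<Rightarrow> real" and I0 :: "'a::euclidean_space set"
    and \<omega> :: "nat \<Rightarrow> moran_param" and I :: "nat list \<Rightarrow> 'a set" and \<mu> :: "'a measure"
  assumes compact_I0: "compact I0" and diameter_I0: "diameter I0 = 1"
    and \<tau>_pos: "0 < \<tau>" and \<tau>_less_1: "\<tau> < 1"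
    and \<rho>_le: "\<And>t. 1 \<le> t \<Longrightarrow> \<rho> t \<le> 1/2"
    and param: "\<And>n. \<omega> n \<in> Omega0 \<rho>"
    and construction: "moran_construction \<tau> I0 \<omega> I"
    and moran_measure: "moran_measure \<omega> I \<mu>"
begin

abbreviation r where "r n \<equiv> ratio (\<omega> n)"
abbreviation D where "D \<equiv> diam_prod \<omega>"

sublocale prob_space \<mu>
  using moran_measure by (simp add: moran_measure_def)

lemma sets_\<mu> [measurable_cong, simp]: "sets \<mu> = sets borel"
  using moran_measure by (simp add: moran_measure_def)

section \<open>Diameters of the Moran sets and their decay\<close>

lemma r_pos: "0 < r n" and r_le: "r n \<le> 1/2"
  using Omega0_cases[OF param[of n]] \<rho>_le[of "children_count (\<omega> n)"] by auto

lemma D_0: "D 0 = 1" and D_Suc: "D (Suc n) = D n * r n"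
  by (auto simp: diam_prod_def)

lemma D_pos: "0 < D n"
  unfolding diam_prod_def by (intro prod_pos) (auto simp: r_pos)

lemma D_split: "n \<le> k \<Longrightarrow> D k = D n * (\<Prod>i\<in>{n..<k}. r i)"
  unfolding diam_prod_def
  using prod.atLeastLessThan_concat[of 0 n k r] by (simp add: lessThan_atLeast0)

lemma D_drop: "n \<le> k \<Longrightarrow> D k \<le> D n / 2 ^ (k - n)"
proof (induction k rule: dec_induct)
  case (step k)
  have "D (Suc k) \<le> D k * (1/2)"
    unfolding D_Suc using r_le D_pos by (intro mult_left_mono) (auto intro: less_imp_le)
  also have "\<dots> \<le> D n / 2 ^ (k - n) * (1/2)"
    using step by simp
  finally show ?case using step by (simp add: Suc_diff_le)
qed simp

lemma D_antimono: "n \<le> k \<Longrightarrow> D k \<le> D n"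
proof -
  assume "n \<le> k"
  have "D n / 2 ^ (k - n) \<le> D n / 1"
    by (intro divide_left_mono less_imp_le[OF D_pos]) auto
  with D_drop[OF \<open>n \<le> k\<close>] show ?thesis by simp
qed

lemma D_le: "D n \<le> 1 / 2 ^ n"
  using D_drop[of 0 n] by (simp add: D_0)

lemma D_tendsto_0: "D \<longlonglongrightarrow> 0"
proof (rule real_tendsto_sandwich[where f = "\<lambda>_. 0" and h = "\<lambda>n. (1/2)^n"])
  show "\<forall>\<^sub>F n in sequentially. 0 \<le> D n"
    using D_pos by (simp add: less_imp_le)
  show "\<forall>\<^sub>F n in sequentially. D n \<le> (1/2)^n"
    using D_le by (simp add: power_divide)
qed (auto intro: LIMSEQ_power_zero)

text \<open>The first index with diameter below s is positive because D 0 = 1 \<ge> s; its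
  predecessor is the step matching the scale s.\<close>

lemma D_bracket:
  assumes "0 < s" "s \<le> 1"
  obtains n where "s \<le> D n" "D (Suc n) < s"
proof -
  have "\<exists>n. D n < s"
    using order_tendstoD(2)[OF D_tendsto_0 assms(1)] eventually_sequentially by auto
  then have "D (LEAST n. D n < s) < s" (is "D ?n < s") by (rule LeastI_ex)
  moreover from this assms have "?n \<noteq> 0" by (metis D_0 not_le)
  moreover from this have "\<not> D (?n - 1) < s" by (intro not_less_Least) simp
  ultimately show ?thesis using that[of "?n - 1"] by simp
qed

section \<open>Words and the geometry of Moran sets\<close>

lemma words_0: "moran_words \<omega> 0 = {[]}"
  by (auto simp: moran_words_def)

lemma words_Suc:
  "moran_words \<omega> (Suc n) = {u @ [j] |u j. u \<in> moran_words \<omega> n \<and> j < children_count (\<omega> n)}"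
proof (intro set_eqI iffI)
  fix w assume w: "w \<in> moran_words \<omega> (Suc n)"
  then have "w = butlast w @ [last w]"
    by (auto simp: moran_words_def intro: append_butlast_last_id[symmetric])
  moreover have "butlast w \<in> moran_words \<omega> n"
    using w by (auto simp: moran_words_def nth_butlast)
  moreover have "last w < children_count (\<omega> n)"
    using w by (cases w rule: rev_cases) (auto simp: moran_words_def nth_append)
  ultimately show "w \<in> {u @ [j] |u j. u \<in> moran_words \<omega> n \<and> j < children_count (\<omega> n)}"
    by blast
next
  fix w assume "w \<in> {u @ [j] |u j. u \<in> moran_words \<omega> n \<and> j < children_count (\<omega> n)}"
  then show "w \<in> moran_words \<omega> (Suc n)"
    by (auto simp: moran_words_def nth_append less_Suc_eq)
qed

lemma finite_words: "finite (moran_words \<omega> n)"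
proof (induction n)
  case (Suc n)
  have "moran_words \<omega> (Suc n) = (\<lambda>(u, j). u @ [j]) ` (moran_words \<omega> n \<times> {..<children_count (\<omega> n)})"
    by (auto simp: words_Suc)
  with Suc show ?case by simp
qed (simp add: words_0)

lemma take_words: "w \<in> moran_words \<omega> k \<Longrightarrow> n \<le> k \<Longrightarrow> take n w \<in> moran_words \<omega> n"
  by (auto simp: moran_words_def)

lemma I_Nil: "I [] = I0"
  using construction by (simp add: moran_construction_def)

lemma separated:
  "w \<in> moran_words \<omega> n \<Longrightarrow>
     separated_similarities \<tau> (r n) (I w) (children_count (\<omega> n)) (\<lambda>j. I (w @ [j]))"
  using construction by (simp add: moran_construction_def)

lemma I_child_subset:
  "w \<in> moran_words \<omega> n \<Longrightarrow> j < children_count (\<omega> n) \<Longrightarrow> I (w @ [j]) \<subseteq> I w"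
  using separated[of w n] by (auto simp: separated_similarities_def r_similarity_def)

text \<open>Similarities are continuous, so compactness passes to children, and the ratio prescribes
  their diameter. The initial set is nonempty because its diameter is not 0.\<close>

lemma I_props:
  "w \<in> moran_words \<omega> n \<Longrightarrow> compact (I w) \<and> I w \<noteq> {} \<and> diameter (I w) = D n"
proof (induction n arbitrary: w)
  case 0
  then have "w = []" by (simp add: words_0)
  moreover have "I0 \<noteq> {}" using diameter_I0 by auto
  ultimately show ?case by (simp add: I_Nil compact_I0 diameter_I0 D_0)
next
  case (Suc n)
  then obtain u j where w: "w = u @ [j]" "u \<in> moran_words \<omega> n" "j < children_count (\<omega> n)"
    by (auto simp: words_Suc)
  from separated[OF w(2)] w(3) have "r_similarity (r n) (I u) (I w)"
    by (auto simp: separated_similarities_def w(1))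
  then obtain S where S: "similarity S" "I w = S ` I u" "diameter (I w) = r n * diameter (I u)"
    by (auto simp: r_similarity_def)
  from S(1) obtain c where c: "0 < c" "\<And>x y. dist (S x) (S y) = c * dist x y"
    by (auto simp: similarity_def)
  have "continuous_on (I u) S"
    by (rule lipschitz_on_continuous_on[of c]) (use c in \<open>auto simp: lipschitz_on_def\<close>)
  with Suc.IH[OF w(2)] S show ?case
    by (auto simp: D_Suc intro!: compact_continuous_image)
qed

lemma I_subset_take: "w \<in> moran_words \<omega> k \<Longrightarrow> n \<le> k \<Longrightarrow> I w \<subseteq> I (take n w)"
proof (induction k arbitrary: w)
  case (Suc k)
  show ?case
  proof (cases "n = Suc k")
    case True
    with Suc.prems show ?thesis by (auto simp: moran_words_def)
  next
    case False
    from Suc.prems obtain u j where w: "w = u @ [j]" "u \<in> moran_words \<omega> k" "j < children_count (\<omega> k)"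
      by (auto simp: words_Suc)
    then have "take n w = take n u" using False Suc.prems by (auto simp: moran_words_def)
    with Suc.IH[OF w(2)] I_child_subset[OF w(2,3)] False Suc.prems w(1) show ?thesis by auto
  qed
qed (auto simp: words_0)

text \<open>Distinct words of equal length part at some step. The siblings there are at distance at
  least \<tau> times their diameter, later Moran sets lie inside these siblings, and later diameters
  are no larger.\<close>

lemma I_separated:
  "w \<in> moran_words \<omega> n \<Longrightarrow> v \<in> moran_words \<omega> n \<Longrightarrow> w \<noteq> v \<Longrightarrow> x \<in> I w \<Longrightarrow> y \<in> I v \<Longrightarrow>
     \<tau> * D n \<le> dist x y"
proof (induction n arbitrary: w v)
  case (Suc n)
  obtain u i where w: "w = u @ [i]" "u \<in> moran_words \<omega> n" "i < children_count (\<omega> n)"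
    using Suc.prems by (auto simp: words_Suc)
  obtain u' j where v: "v = u' @ [j]" "u' \<in> moran_words \<omega> n" "j < children_count (\<omega> n)"
    using Suc.prems by (auto simp: words_Suc)
  show ?case
  proof (cases "u = u'")
    case True
    with Suc.prems w v have "i \<noteq> j" by auto
    with separated[OF w(2)] w v True
    have "\<tau> * r n * diameter (I u) \<le> setdist (I w) (I v)"
      by (auto simp: separated_similarities_def)
    also have "\<dots> \<le> dist x y" using Suc.prems by (intro setdist_le_dist)
    finally show ?thesis using I_props[OF w(2)] by (simp add: D_Suc mult_ac)
  next
    case False
    have "\<tau> * D (Suc n) \<le> \<tau> * D n"
      using \<tau>_pos D_antimono[of n "Suc n"] by simp
    also have "\<dots> \<le> dist x y"
      using Suc.IH[OF w(2) v(2) False] Suc.prems I_child_subset[OF w(2,3)] I_child_subset[OF v(2,3)] w(1) v(1)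
      by auto
    finally show ?thesis .
  qed
qed (auto simp: words_0)

section \<open>Masses of Moran sets\<close>

lemma measure_I: "w \<in> moran_words \<omega> n \<Longrightarrow> measure \<mu> (I w) = (\<Prod>k<n. weight (\<omega> k) (w ! k))"
proof (induction n arbitrary: w)
  case 0
  then show ?case using moran_measure by (simp add: words_0 moran_measure_def)
next
  case (Suc n)
  then obtain u j where w: "w = u @ [j]" "u \<in> moran_words \<omega> n" "j < children_count (\<omega> n)"
    by (auto simp: words_Suc)
  have len: "length u = n" using w by (simp add: moran_words_def)
  have "measure \<mu> (I w) = measure \<mu> (I u) * weight (\<omega> n) j"
    using moran_measure w by (auto simp: moran_measure_def)
  also have "\<dots> = (\<Prod>k<n. weight (\<omega> k) (w ! k)) * weight (\<omega> n) (w ! n)"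
    using len unfolding Suc.IH[OF w(2)] by (simp add: w(1) nth_append)
  finally show ?case by simp
qed

lemma word_nth: "w \<in> moran_words \<omega> k \<Longrightarrow> i < k \<Longrightarrow> w ! i < children_count (\<omega> i)"
  by (auto simp: moran_words_def)

lemma measure_I_pos: "w \<in> moran_words \<omega> n \<Longrightarrow> 0 < measure \<mu> (I w)"
  unfolding measure_I
  by (intro prod_pos) (auto intro: Omega0_weight_pos[OF param] simp: word_nth)

lemma measure_I_take:
  assumes "w \<in> moran_words \<omega> k" "n \<le> k"
  shows "measure \<mu> (I w) = measure \<mu> (I (take n w)) * (\<Prod>i\<in>{n..<k}. weight (\<omega> i) (w ! i))"
proof -
  have "measure \<mu> (I (take n w)) = (\<Prod>i<n. weight (\<omega> i) (w ! i))"
    unfolding measure_I[OF take_words[OF assms]] by (intro prod.cong) auto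
  then show ?thesis
    unfolding measure_I[OF assms(1)] using assms(2)
    using prod.atLeastLessThan_concat[of 0 n k "\<lambda>i. weight (\<omega> i) (w ! i)"]
    by (simp add: lessThan_atLeast0)
qed

section \<open>The support and the masses of balls\<close>

lemma moran_set_AE: "AE x in \<mu>. x \<in> moran_set \<omega> I"
  using moran_measure by (simp add: moran_measure_def)

lemma closed_moran_set: "closed (moran_set \<omega> I)"
  unfolding moran_set_def
  by (intro closed_INT ballI closed_UN finite_words) (auto intro: compact_imp_closed simp: I_props)

text \<open>The random Moran set is closed and carries all the mass, so its complement is an open
  null set, which contains no point of the support.\<close>

lemma support_subset: "measure_support \<mu> \<subseteq> moran_set \<omega> I"
proof
  fix x assume x: "x \<in> measure_support \<mu>"
  show "x \<in> moran_set \<omega> I"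
  proof (rule ccontr)
    assume "x \<notin> moran_set \<omega> I"
    with x have "0 < emeasure \<mu> (- moran_set \<omega> I)"
      using closed_moran_set unfolding measure_support_def by (auto simp: open_Compl)
    moreover have "emeasure \<mu> (- moran_set \<omega> I) = 0"
    proof -
      have "AE x in \<mu>. x \<notin> - moran_set \<omega> I" using moran_set_AE by simp
      moreover have "- moran_set \<omega> I \<in> sets \<mu>"
        using closed_moran_set by (simp add: open_Compl borel_open)
      ultimately have "- moran_set \<omega> I \<in> null_sets \<mu>"
        using AE_iff_null_sets by blast
      then show ?thesis by (rule null_setsD1)
    qed
    ultimately show False by simp
  qed
qed

lemma support_word:
  assumes "x \<in> measure_support \<mu>"
  obtains w where "w \<in> moran_words \<omega> n" "x \<in> I w"
  using support_subset assms by (auto simp: moran_set_def)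

text \<open>By separation such a ball meets no other step n Moran set, and almost every point lies
  in some step n Moran set.\<close>

lemma measure_ball_le:
  assumes "w \<in> moran_words \<omega> n" "x \<in> I w" "R \<le> \<tau> * D n"
  shows "measure \<mu> (ball x R) \<le> measure \<mu> (I w)"
proof (rule finite_measure_mono_AE)
  show "AE y in \<mu>. y \<in> ball x R \<longrightarrow> y \<in> I w"
    using moran_set_AE
  proof eventually_elim
    case (elim y)
    then obtain v where v: "v \<in> moran_words \<omega> n" "y \<in> I v" by (auto simp: moran_set_def)
    show ?case
    proof
      assume "y \<in> ball x R"
      then have "dist x y < \<tau> * D n" using assms(3) by simp
      with I_separated[OF assms(1) v(1) _ assms(2) v(2)] v(2) show "y \<in> I w" by force
    qed
  qed
  show "I w \<in> sets \<mu>" using I_props[OF assms(1)] by (auto intro: borel_compact)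
qed

lemma I_subset_ball:
  assumes "w \<in> moran_words \<omega> n" "x \<in> I w" "D n < R"
  shows "I w \<subseteq> ball x R"
proof
  fix y assume "y \<in> I w"
  with diameter_bounded_bound[of "I w" x y] I_props[OF assms(1)] assms
  have "dist x y \<le> D n" by (auto intro: compact_imp_bounded)
  with assms show "y \<in> ball x R" by simp
qed

lemma measure_ball_ge:
  assumes "w \<in> moran_words \<omega> n" "x \<in> I w" "D n < R"
  shows "measure \<mu> (I w) \<le> measure \<mu> (ball x R)"
  by (intro finite_measure_mono I_subset_ball[OF assms]) auto

lemma measure_ball_pos:
  assumes "x \<in> measure_support \<mu>" "0 < s"
  shows "0 < measure \<mu> (ball x s)"
  using assms by (auto simp: measure_support_def emeasure_eq_measure)

text \<open>An infinite path gives nested nonempty compact sets with a common point. Every ball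
  around that point contains a Moran set of positive mass, so the point is in the support. Paths of
  extremal weights will give the test points for the dimensions.\<close>

lemma branch_point:
  assumes s: "\<And>k. s k < children_count (\<omega> k)"
  obtains x where "x \<in> measure_support \<mu>" "\<And>n. map s [0..<n] \<in> moran_words \<omega> n"
    "\<And>n. x \<in> I (map s [0..<n])"
proof -
  have w: "map s [0..<n] \<in> moran_words \<omega> n" for n
    using s by (auto simp: moran_words_def)
  have sub: "I (map s [0..<k]) \<subseteq> I (map s [0..<n])" if "n \<le> k" for n k
    using I_subset_take[OF w that] that by (simp add: take_map)
  have "(\<Inter>n. I (map s [0..<n])) \<noteq> {}"
    by (rule compact_nest) (use I_props[OF w] sub in auto)
  then obtain x where x: "\<And>n. x \<in> I (map s [0..<n])" by auto
  have "x \<in> measure_support \<mu>"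
    unfolding measure_support_def
  proof (safe)
    fix U assume U: "open U" "x \<in> U"
    then obtain e where e: "0 < e" "ball x e \<subseteq> U" by (auto simp: open_contains_ball)
    obtain n where "D n < e"
      using order_tendstoD(2)[OF D_tendsto_0 e(1)] eventually_sequentially by auto
    then have "0 < measure \<mu> (ball x e)"
      using measure_ball_ge[OF w x] measure_I_pos[OF w] by (meson less_le_trans)
    also have "\<dots> \<le> measure \<mu> U" using e U by (intro finite_measure_mono) auto
    finally show "0 < emeasure \<mu> U" by (simp add: emeasure_eq_measure)
  qed
  with w x that show ?thesis by blast
qed

text \<open>The mass quotient of nested Moran sets is the product of the inverse weights in between.
  The larger ball contains the outer Moran set, and the smaller ball has at most the mass of the
  inner one.\<close>

lemma ratio_ge:
  assumes w: "w \<in> moran_words \<omega> k" "x \<in> I w" and "n \<le> k" "D n < R" "s \<le> \<tau> * D k"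
    and x: "x \<in> measure_support \<mu>" and "0 < s"
  shows "(\<Prod>i\<in>{n..<k}. 1 / weight (\<omega> i) (w ! i)) \<le> measure \<mu> (ball x R) / measure \<mu> (ball x s)"
proof -
  have "(\<Prod>i\<in>{n..<k}. 1 / weight (\<omega> i) (w ! i)) = measure \<mu> (I (take n w)) / measure \<mu> (I w)"
    using measure_I_take[OF w(1) \<open>n \<le> k\<close>] measure_I_pos[OF w(1)] measure_I_pos[OF take_words[OF w(1) \<open>n \<le> k\<close>]]
    by (simp add: prod_dividef)
  also have "\<dots> \<le> measure \<mu> (ball x R) / measure \<mu> (ball x s)"
  proof (rule frac_le)
    show "measure \<mu> (I (take n w)) \<le> measure \<mu> (ball x R)"
      using I_subset_take[OF w(1) \<open>n \<le> k\<close>] assms by (intro measure_ball_ge[OF take_words]) auto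
    show "measure \<mu> (ball x s) \<le> measure \<mu> (I w)"
      using assms by (intro measure_ball_le)
  qed (use measure_ball_pos[OF x \<open>0 < s\<close>] in auto)
  finally show ?thesis .
qed

text \<open>The roles are exchanged: the larger ball has at most the mass of the outer Moran set,
  and the smaller ball contains the inner one.\<close>

lemma ratio_le:
  assumes w: "w \<in> moran_words \<omega> k" "x \<in> I w" and "n \<le> k" "R \<le> \<tau> * D n" "D k < s"
  shows "measure \<mu> (ball x R) / measure \<mu> (ball x s) \<le> (\<Prod>i\<in>{n..<k}. 1 / weight (\<omega> i) (w ! i))"
proof -
  have "measure \<mu> (ball x R) / measure \<mu> (ball x s) \<le> measure \<mu> (I (take n w)) / measure \<mu> (I w)"
  proof (rule frac_le)
    show "measure \<mu> (ball x R) \<le> measure \<mu> (I (take n w))"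
      using I_subset_take[OF w(1) \<open>n \<le> k\<close>] assms by (intro measure_ball_le[OF take_words]) auto
    show "measure \<mu> (I w) \<le> measure \<mu> (ball x s)"
      using assms by (intro measure_ball_ge)
  qed (use measure_I_pos[OF w(1)] in auto)
  also have "\<dots> = (\<Prod>i\<in>{n..<k}. 1 / weight (\<omega> i) (w ! i))"
    using measure_I_take[OF w(1) \<open>n \<le> k\<close>] measure_I_pos[OF w(1)] measure_I_pos[OF take_words[OF w(1) \<open>n \<le> k\<close>]]
    by (simp add: prod_dividef)
  finally show ?thesis .
qed

text \<open>The ratios telescope, so bounds on single weights by powers of ratios become bounds by
  powers of quotients of diameters.\<close>

lemma D_quotient: "n \<le> k \<Longrightarrow> (\<Prod>i\<in>{n..<k}. 1 / r i powr a) = (D n / D k) powr a"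
proof -
  assume "n \<le> k"
  have "(\<Prod>i\<in>{n..<k}. 1 / r i powr a) = 1 / (\<Prod>i\<in>{n..<k}. r i) powr a"
    by (simp add: prod_dividef prod_powr_distrib[symmetric] less_imp_le[OF r_pos])
  also have "(\<Prod>i\<in>{n..<k}. r i) = D k / D n"
    using D_split[OF \<open>n \<le> k\<close>] D_pos[of n] by simp
  finally show ?thesis
    using D_pos[of n] D_pos[of k] by (simp add: powr_divide less_imp_le)
qed

end

section \<open>Dimension bounds for a realisation\<close>

context moran_realisation
begin

text \<open>The estimate is proved at all scales s < R \<le> \<tau> and so serves every \<Phi>. Each
  inverse weight is at least r^(-b), and the lower bound on the ratios keeps R and s comparable to
  diameters. For b = 0, monotonicity of \<mu> is enough.\<close>

lemma lower_phi_dim_ge: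
  assumes b: "0 \<le> b" and M: "\<And>n. max_weight (\<omega> n) \<le> r n powr b"
    and c: "b = 0 \<or> (\<exists>c>0. \<forall>n. c \<le> r n)"
  shows "ereal b \<le> lower_phi_dim \<Phi> \<mu>"
proof -
  have mono: "1 \<le> measure \<mu> (ball x R) / measure \<mu> (ball x s)"
    if "x \<in> measure_support \<mu>" "0 < s" "s < R" for x s R
    using measure_ball_pos[OF that(1,2)] that(3)
    by (simp add: finite_measure_mono subset_ball)
  have "\<exists>C1>0. \<exists>C2>0. \<forall>(s, R)\<in>phi_scales \<Phi> C1. \<forall>x\<in>measure_support \<mu>.
       C2 * (R / s) powr b \<le> measure \<mu> (ball x R) / measure \<mu> (ball x s)"
  proof (cases "b = 0")
    case True
    show ?thesis
      by (intro exI[of _ 1] conjI) (auto simp: True phi_scalesD(1,2) intro!: mono[simplified])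
  next
    case False
    with c obtain c where c: "0 < c" "\<And>n. c \<le> r n" by auto
    have c1: "c \<le> 1" using c(2)[of 0] r_le[of 0] by simp
    have D_c: "c * D n \<le> D (Suc n)" for n
      using c(2)[of n] D_pos[of n] by (simp add: D_Suc)
    have "(c\<^sup>2 * \<tau>) powr b * (R / s) powr b \<le> measure \<mu> (ball x R) / measure \<mu> (ball x s)"
      if sR: "0 < s" "s < R" "R \<le> \<tau>" and x: "x \<in> measure_support \<mu>" for s R x
    proof -
      \<comment> \<open>The outer Moran set is taken at step \<open>Suc n\<close>, so that it fits
        into the ball of radius R. Rounding each scale to a diameter costs one factor c per end,
        which together with \<tau> gives the constant.\<close>
      obtain n where n: "R \<le> D n" "D (Suc n) < R"
        using D_bracket[of R] sR \<tau>_less_1 by auto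
      obtain k where k: "s / \<tau> \<le> D k" "D (Suc k) < s / \<tau>"
        using D_bracket[of "s / \<tau>"] sR \<tau>_pos by auto
      have ck: "c * \<tau> * D k \<le> s"
      proof -
        have "c * D k \<le> s / \<tau>" using D_c[of k] k by simp
        then show ?thesis using \<tau>_pos by (simp add: field_simps)
      qed
      have "(c\<^sup>2 * \<tau>) powr b * (R / s) powr b = (c\<^sup>2 * \<tau> * (R / s)) powr b"
        using c \<tau>_pos sR by (subst powr_mult[of _ "R / s"]) auto
      also have "\<dots> \<le> measure \<mu> (ball x R) / measure \<mu> (ball x s)"
      proof (cases "Suc n \<le> k")
        case True
        obtain w where w: "w \<in> moran_words \<omega> k" "x \<in> I w" by (rule support_word[OF x])
        have "c\<^sup>2 * \<tau> * (R / s) \<le> D (Suc n) / D k"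
        proof -
          have "c * R \<le> D (Suc n)"
            using c(1) n(1) D_c[of n] by (meson less_imp_le mult_left_mono order_trans)
          then have "(c * R) * (c * \<tau> * D k) \<le> D (Suc n) * s"
            using ck c(1) \<tau>_pos D_pos[of k] sR by (intro mult_mono) (auto intro: less_imp_le[OF D_pos])
          then show ?thesis using sR D_pos[of k] by (simp add: field_simps power2_eq_square)
        qed
        then have "(c\<^sup>2 * \<tau> * (R / s)) powr b \<le> (D (Suc n) / D k) powr b"
          using b c \<tau>_pos sR by (intro powr_mono2) auto
        also have "\<dots> = (\<Prod>i\<in>{Suc n..<k}. 1 / r i powr b)" by (simp add: D_quotient[OF True])
        also have "\<dots> \<le> (\<Prod>i\<in>{Suc n..<k}. 1 / weight (\<omega> i) (w ! i))"
        proof (rule prod_mono, safe)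
          fix i assume "i \<in> {Suc n..<k}"
          then have i: "w ! i < children_count (\<omega> i)" using word_nth[OF w(1)] by simp
          show "1 / r i powr b \<le> 1 / weight (\<omega> i) (w ! i)"
            using max_weight_ge[OF i] M[of i] r_pos[of i] Omega0_weight_pos[OF param i]
            by (intro divide_left_mono) auto
        qed simp
        also have "\<dots> \<le> measure \<mu> (ball x R) / measure \<mu> (ball x s)"
          using k(1) \<tau>_pos n by (intro ratio_ge w True x sR) (simp_all add: field_simps)
        finally show ?thesis .
      next
        \<comment> \<open>No step lies strictly between the two scales: R is at most s / (c \<tau>),
          the left side is at most 1, and monotonicity of \<mu> suffices.\<close>
        case False
        then have "R \<le> D k" using n(1) D_antimono[of k n] by simp
        then have "c * \<tau> * R \<le> s"
          using ck c(1) \<tau>_pos by (meson less_imp_le mult_left_mono mult_pos_pos order_trans)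
        then have "c * (c * \<tau> * R) \<le> 1 * s"
          using c c1 \<tau>_pos sR by (intro mult_mono) auto
        then have "c\<^sup>2 * \<tau> * (R / s) \<le> 1" using sR by (simp add: field_simps power2_eq_square)
        then have "(c\<^sup>2 * \<tau> * (R / s)) powr b \<le> 1 powr b"
          using b c \<tau>_pos sR by (intro powr_mono2) auto
        with mono[OF x sR(1,2)] show ?thesis by simp
      qed
      finally show ?thesis .
    qed
    then show ?thesis
      using \<tau>_pos c(1)
      by (intro exI[of _ \<tau>] conjI exI[of _ "(c\<^sup>2 * \<tau>) powr b"]) (auto dest: phi_scalesD)
  qed
  then show ?thesis
    unfolding lower_phi_dim_def by (intro Sup_upper) blast
qed

text \<open>All scales s < R \<le> \<tau> are treated at once. Each inverse weight is at most
  r^(-a). At the first and the last step, where R and s fall between consecutive diameters, the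
  bound 1/c is used instead.\<close>

lemma upper_phi_dim_le:
  assumes a: "0 \<le> a" and m: "\<And>n. r n powr a \<le> min_weight (\<omega> n)"
    and c: "0 < c" "\<And>n. c \<le> min_weight (\<omega> n)"
  shows "upper_phi_dim \<Phi> \<mu> \<le> ereal a"
proof -
  have c1: "c < 1" using c(2)[of 0] min_weight_bounds[OF param[of 0]] by simp
  have "measure \<mu> (ball x R) / measure \<mu> (ball x s) \<le> 1 / (c\<^sup>2 * \<tau> powr a) * (R / s) powr a"
    if sR: "0 < s" "s < R" "R \<le> \<tau>" and x: "x \<in> measure_support \<mu>" for s R x
  proof -
    obtain n where n: "R / \<tau> \<le> D n" "D (Suc n) < R / \<tau>"
      using D_bracket[of "R / \<tau>"] sR \<tau>_pos by auto
    obtain k where k: "s \<le> D k" "D (Suc k) < s"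
      using D_bracket[of s] sR \<tau>_less_1 by auto
    have "R * 1 \<le> R / \<tau>"
      using \<tau>_pos \<tau>_less_1 sR by (simp add: field_simps)
    then have "D (Suc k) < D n" using n k sR by simp
    then have nk: "n \<le> k" using D_antimono[of "Suc k" n] by (meson not_less not_less_eq_eq)
    obtain w where w: "w \<in> moran_words \<omega> (Suc k)" "x \<in> I w" by (rule support_word[OF x])
    let ?q = "\<lambda>i. 1 / weight (\<omega> i) (w ! i)"
    have q: "0 \<le> ?q i" "?q i \<le> 1 / c" "?q i \<le> 1 / r i powr a" if "i < Suc k" for i
    proof -
      have i: "w ! i < children_count (\<omega> i)" using word_nth[OF w(1) that] .
      have *: "0 < weight (\<omega> i) (w ! i)" "min_weight (\<omega> i) \<le> weight (\<omega> i) (w ! i)"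
        using Omega0_weight_pos[OF param i] min_weight_le[OF i] by auto
      then show "0 \<le> ?q i" by simp
      show "?q i \<le> 1 / c" using * c(1) c(2)[of i] by (intro divide_left_mono) auto
      show "?q i \<le> 1 / r i powr a"
        using * m[of i] r_pos[of i] by (intro divide_left_mono) auto
    qed
    have "measure \<mu> (ball x R) / measure \<mu> (ball x s) \<le> (\<Prod>i\<in>{n..<Suc k}. ?q i)"
      using n k \<tau>_pos nk by (intro ratio_le w) (auto simp: field_simps)
    also have "\<dots> \<le> 1 / c\<^sup>2 * (R / (\<tau> * s)) powr a"
    proof (cases "n = k")
      \<comment> \<open>The product has a single factor, at most 1/c; as c < 1, it fits under the
        same constant as the general case.\<close>
      case True
      have "(\<Prod>i\<in>{n..<Suc k}. ?q i) \<le> 1 / c" using q(2)[of k] by (simp add: True)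
      also have "\<dots> \<le> 1 / c\<^sup>2 * 1"
        using c(1) c1 by (simp add: field_simps power2_eq_square)
      also have "\<dots> \<le> 1 / c\<^sup>2 * (R / (\<tau> * s)) powr a"
      proof (intro mult_left_mono ge_one_powr_ge_zero)
        have "\<tau> * s \<le> 1 * R" using sR \<tau>_pos \<tau>_less_1 by (intro mult_mono) auto
        then show "1 \<le> R / (\<tau> * s)" using sR \<tau>_pos by (simp add: field_simps)
      qed (use a in auto)
      finally show ?thesis .
    next
      case False
      then have nk': "Suc n \<le> k" using nk by simp
      have "(\<Prod>i\<in>{n..<Suc k}. ?q i) = ?q n * ((\<Prod>i\<in>{Suc n..<k}. ?q i) * ?q k)"
        using nk' by (simp add: prod.atLeast_Suc_lessThan)
      also have "\<dots> \<le> 1 / c * ((\<Prod>i\<in>{Suc n..<k}. 1 / r i powr a) * (1 / c))"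
        using q nk' c(1) by (intro mult_mono prod_mono mult_nonneg_nonneg prod_nonneg) auto
      also have "\<dots> = 1 / c\<^sup>2 * (D (Suc n) / D k) powr a"
        by (simp add: D_quotient[OF nk'] power2_eq_square)
      also have "\<dots> \<le> 1 / c\<^sup>2 * (R / (\<tau> * s)) powr a"
      proof (intro mult_left_mono powr_mono2)
        have "D (Suc n) / D k \<le> (R / \<tau>) / s"
          using n k sR \<tau>_pos by (intro frac_le) (auto intro: less_imp_le[OF D_pos])
        then show "D (Suc n) / D k \<le> R / (\<tau> * s)" by simp
        show "0 \<le> D (Suc n) / D k" by (intro divide_nonneg_nonneg less_imp_le[OF D_pos])
      qed (use a in auto)
      finally show ?thesis .
    qed
    also have "\<dots> = 1 / (c\<^sup>2 * \<tau> powr a) * (R / s) powr a"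
      using sR \<tau>_pos by (simp add: powr_mult powr_divide)
    finally show ?thesis .
  qed
  then have "\<exists>C1>0. \<exists>C2>0. \<forall>(s, R)\<in>phi_scales \<Phi> C1. \<forall>x\<in>measure_support \<mu>.
       measure \<mu> (ball x R) / measure \<mu> (ball x s) \<le> C2 * (R / s) powr a"
    using \<tau>_pos c(1)
    by (intro exI[of _ \<tau>] conjI exI[of _ "1 / (c\<^sup>2 * \<tau> powr a)"]) (auto dest: phi_scalesD)
  then show ?thesis
    unfolding upper_phi_dim_def by (intro Inf_lower) blast
qed

section \<open>Bounds from windows of nearly extremal coordinates\<close>

lemma D_quotient_ge: "2 ^ L \<le> D n / D (n + L)"
  using D_drop[of n "n + L"] D_pos[of "n + L"] D_pos[of n] by (simp add: field_simps)

text \<open>If some d < a were admissible, the branch of minimal weights would give Q^a \<le> C2 (2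
  Q / \<tau>)^d across each window, where Q = D n / D k \<ge> 2^L. This fails for large L. One
  branch, hence one point, serves all windows.\<close>

lemma upper_phi_dim_ge:
  assumes small: "small_dimension_function \<Phi>"
    and growth: "\<And>n. - ln (D n) \<le> H * (real n + 1) ^ 3" and B: "0 < B"
    and windows: "\<forall>\<^sub>F L in sequentially. \<exists>i\<in>{1..L * B ^ L}. \<forall>k\<in>{i * L..<i * L + L}.
      min_weight (\<omega> k) \<le> r k powr a"
  shows "ereal a \<le> upper_phi_dim \<Phi> \<mu>"
  unfolding upper_phi_dim_def
proof (rule Inf_greatest, safe, rule ccontr)
  fix d C1 C2 :: real
  assume d: "\<not> ereal a \<le> ereal d" and C: "0 < C1" "0 < C2"
    and bound: "\<forall>(s, R)\<in>phi_scales \<Phi> C1. \<forall>x\<in>measure_support \<mu>.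
       measure \<mu> (ball x R) / measure \<mu> (ball x s) \<le> C2 * (R / s) powr d"
  have "\<exists>s. \<forall>k. s k < children_count (\<omega> k) \<and> weight (\<omega> k) (s k) = min_weight (\<omega> k)"
    by (intro choice allI) (metis min_weight_attained[OF param])
  then obtain s where s: "\<And>k. s k < children_count (\<omega> k)" "\<And>k. weight (\<omega> k) (s k) = min_weight (\<omega> k)"
    by auto
  obtain x where x: "x \<in> measure_support \<mu>" "\<And>n. map s [0..<n] \<in> moran_words \<omega> n"
    "\<And>n. x \<in> I (map s [0..<n])"
    using branch_point[OF s(1)] by blast
  have "\<forall>\<^sub>F L in sequentially. C2 * (2 / \<tau>) powr d < (2 ^ L) powr (a - d)"
    using d by (intro eventually_powr_gt) simp
  moreover have "\<forall>\<^sub>F L in sequentially. \<forall>n k. L \<le> n \<longrightarrow> n \<le> L * (L * B ^ L) \<longrightarrow> n + L \<le> k \<longrightarrow>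
    (\<tau> * D k, 2 * D n) \<in> phi_scales \<Phi> C1"
    by (rule small_dimension_function_scales[OF small D_pos D_le D_drop growth _ \<tau>_pos C(1) B]) auto
  ultimately have "\<forall>\<^sub>F L in sequentially. False"
    using windows
  proof eventually_elim
    case (elim L)
    obtain i where i: "i \<in> {1..L * B ^ L}"
      "\<And>k. k \<in> {i * L..<i * L + L} \<Longrightarrow> min_weight (\<omega> k) \<le> r k powr a"
      using elim(3) by blast
    \<comment> \<open>As i \<ge> 1, the window starts at n \<ge> L, so its scale tends to 0 as L
      grows; the upper bound on i keeps n exponential in L, as admissibility of the scales
      demands.\<close>
    define n where "n = i * L"
    define k where "k = n + L"
    define Q where "Q = D n / D k"
    have Q: "2 ^ L \<le> Q" unfolding Q_def k_def by (rule D_quotient_ge)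
    have "(0::real) < 2 ^ L" by simp
    with Q have Q_pos: "0 < Q" by linarith
    have n: "L \<le> n" "n \<le> L * (L * B ^ L)"
      using i(1) by (auto simp: n_def mult.commute[of i L] intro: mult_le_mono2)
    have scale: "(\<tau> * D k, 2 * D n) \<in> phi_scales \<Phi> C1"
      using elim(2)[rule_format, OF n] by (simp only: k_def)
    have "Q powr a = (\<Prod>i\<in>{n..<k}. 1 / r i powr a)"
      unfolding Q_def by (rule D_quotient[symmetric]) (simp add: k_def)
    also have "\<dots> \<le> (\<Prod>i\<in>{n..<k}. 1 / weight (\<omega> i) (map s [0..<k] ! i))"
    proof (rule prod_mono, safe)
      fix j assume j: "j \<in> {n..<k}"
      then have "weight (\<omega> j) (map s [0..<k] ! j) = min_weight (\<omega> j)" by (simp add: s(2))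
      moreover have "min_weight (\<omega> j) \<le> r j powr a" using i(2) j by (simp add: n_def k_def)
      ultimately show "1 / r j powr a \<le> 1 / weight (\<omega> j) (map s [0..<k] ! j)"
        using min_weight_bounds[OF param[of j]] r_pos[of j] by (intro divide_left_mono) auto
    qed simp
    also have "\<dots> \<le> measure \<mu> (ball x (2 * D n)) / measure \<mu> (ball x (\<tau> * D k))"
      using x \<tau>_pos D_pos[of n] D_pos[of k] by (intro ratio_ge) (auto simp: k_def)
    also have "\<dots> \<le> C2 * (2 * D n / (\<tau> * D k)) powr d"
      using bound scale x(1) by auto
    also have "2 * D n / (\<tau> * D k) = (2 / \<tau>) * Q" by (simp add: Q_def)
    also have "C2 * ((2 / \<tau>) * Q) powr d = C2 * (2 / \<tau>) powr d * Q powr d"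
      using \<tau>_pos Q_pos by (subst powr_mult) auto
    finally have "Q powr (a - d) \<le> C2 * (2 / \<tau>) powr d"
      using Q_pos by (simp add: powr_diff field_simps)
    moreover have "(2 ^ L) powr (a - d) \<le> Q powr (a - d)"
      using Q d by (intro powr_mono2) auto
    ultimately show False using elim(1) by simp
  qed
  then show False by simp
qed

text \<open>If some d > b were admissible, the branch of maximal weights with radii \<tau> D n and 2
  D k would give C2 (\<tau> Q / 2)^d \<le> Q^b, where again Q = D n / D k \<ge> 2^L.\<close>

lemma lower_phi_dim_le:
  assumes small: "small_dimension_function \<Phi>"
    and growth: "\<And>n. - ln (D n) \<le> H * (real n + 1) ^ 3" and B: "0 < B"
    and windows: "\<forall>\<^sub>F L in sequentially. \<exists>i\<in>{1..L * B ^ L}. \<forall>k\<in>{i * L..<i * L + L}.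
      r k powr b \<le> max_weight (\<omega> k)"
  shows "lower_phi_dim \<Phi> \<mu> \<le> ereal b"
  unfolding lower_phi_dim_def
proof (rule Sup_least, safe, rule ccontr)
  fix d C1 C2 :: real
  assume d: "\<not> ereal d \<le> ereal b" and C: "0 < C1" "0 < C2"
    and bound: "\<forall>(s, R)\<in>phi_scales \<Phi> C1. \<forall>x\<in>measure_support \<mu>.
       C2 * (R / s) powr d \<le> measure \<mu> (ball x R) / measure \<mu> (ball x s)"
  have "\<exists>s. \<forall>k. s k < children_count (\<omega> k) \<and> weight (\<omega> k) (s k) = max_weight (\<omega> k)"
    by (intro choice allI) (metis max_weight_attained[OF param])
  then obtain s where s: "\<And>k. s k < children_count (\<omega> k)" "\<And>k. weight (\<omega> k) (s k) = max_weight (\<omega> k)"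
    by auto
  obtain x where x: "x \<in> measure_support \<mu>" "\<And>n. map s [0..<n] \<in> moran_words \<omega> n"
    "\<And>n. x \<in> I (map s [0..<n])"
    using branch_point[OF s(1)] by blast
  have "\<forall>\<^sub>F L in sequentially. 1 / (C2 * (\<tau> / 2) powr d) < (2 ^ L) powr (d - b)"
    using d by (intro eventually_powr_gt) simp
  moreover have "\<forall>\<^sub>F L in sequentially. \<forall>n k. L \<le> n \<longrightarrow> n \<le> L * (L * B ^ L) \<longrightarrow> n + L \<le> k \<longrightarrow>
    (2 * D k, \<tau> * D n) \<in> phi_scales \<Phi> C1"
    by (rule small_dimension_function_scales[OF small D_pos D_le D_drop growth \<tau>_pos _ C(1) B]) auto
  ultimately have "\<forall>\<^sub>F L in sequentially. False"
    using windows
  proof eventually_elim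
    case (elim L)
    obtain i where i: "i \<in> {1..L * B ^ L}"
      "\<And>k. k \<in> {i * L..<i * L + L} \<Longrightarrow> r k powr b \<le> max_weight (\<omega> k)"
      using elim(3) by blast
    define n where "n = i * L"
    define k where "k = n + L"
    define Q where "Q = D n / D k"
    have Q: "2 ^ L \<le> Q" unfolding Q_def k_def by (rule D_quotient_ge)
    have "(0::real) < 2 ^ L" by simp
    with Q have Q_pos: "0 < Q" by linarith
    have n: "L \<le> n" "n \<le> L * (L * B ^ L)"
      using i(1) by (auto simp: n_def mult.commute[of i L] intro: mult_le_mono2)
    have scale: "(2 * D k, \<tau> * D n) \<in> phi_scales \<Phi> C1"
      using elim(2)[rule_format, OF n] by (simp only: k_def)
    have "C2 * (\<tau> / 2) powr d * Q powr d = C2 * (\<tau> * D n / (2 * D k)) powr d"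
    proof -
      have "\<tau> * D n / (2 * D k) = (\<tau> / 2) * Q" by (simp add: Q_def)
      then show ?thesis using \<tau>_pos Q_pos by (simp only:) (subst powr_mult, auto)
    qed
    also have "\<dots> \<le> measure \<mu> (ball x (\<tau> * D n)) / measure \<mu> (ball x (2 * D k))"
      using bound scale x(1) by auto
    also have "\<dots> \<le> (\<Prod>i\<in>{n..<k}. 1 / weight (\<omega> i) (map s [0..<k] ! i))"
      using x D_pos[of k] by (intro ratio_le) (auto simp: k_def)
    also have "\<dots> \<le> (\<Prod>i\<in>{n..<k}. 1 / r i powr b)"
    proof (rule prod_mono, safe)
      fix j assume j: "j \<in> {n..<k}"
      then have *: "weight (\<omega> j) (map s [0..<k] ! j) = max_weight (\<omega> j)" by (simp add: s(2))
      then show "0 \<le> 1 / weight (\<omega> j) (map s [0..<k] ! j)"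
        using max_weight_bounds[OF param[of j]] by simp
      have "r j powr b \<le> max_weight (\<omega> j)" using i(2) j by (simp add: n_def k_def)
      then show "1 / weight (\<omega> j) (map s [0..<k] ! j) \<le> 1 / r j powr b"
        using * max_weight_bounds[OF param[of j]] r_pos[of j] by (intro divide_left_mono) auto
    qed
    also have "\<dots> = Q powr b"
      unfolding Q_def by (rule D_quotient) (simp add: k_def)
    finally have "Q powr (d - b) \<le> 1 / (C2 * (\<tau> / 2) powr d)"
      using Q_pos C(2) \<tau>_pos by (simp add: powr_diff field_simps)
    moreover have "(2 ^ L) powr (d - b) \<le> Q powr (d - b)"
      using Q d by (intro powr_mono2) auto
    ultimately show False using elim(1) by simp
  qed
  then show False by simp
qed

section \<open>Bounds by the extended reals \<alpha> and \<beta>\<close>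

lemma r_less_1: "r n < 1"
  using r_le[of n] by simp

text \<open>For finite \<beta> > 0, c \<le> M \<le> r^\<beta> gives r \<ge> c^(1/\<beta>), so both
  alternatives reduce to a lower bound on the ratios. For \<beta> \<le> 0 the trivial bound 0 is
  enough.\<close>

lemma lower_phi_dim_ge_essinf:
  fixes \<beta> :: ereal
  assumes M: "\<And>n. \<beta> \<le> ereal (ln (max_weight (\<omega> n)) / ln (r n))"
    and c: "(\<exists>c>0. \<forall>n. c \<le> max_weight (\<omega> n)) \<or> (\<exists>c>0. \<forall>n. c \<le> r n)"
  shows "\<beta> \<le> lower_phi_dim \<Phi> \<mu>"
proof (cases \<beta>)
  case (real b)
  have M': "max_weight (\<omega> n) \<le> r n powr b" for n
    using M[of n] log_quotient_le_iff(2)[OF r_pos r_less_1 max_weight_bounds(1)[OF param], of b n n]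
    by (simp add: real)
  show ?thesis
  proof (cases "0 < b")
    case True
    have "\<exists>c>0. \<forall>n. c \<le> r n"
    proof (rule disjE[OF c])
      assume "\<exists>c>0. \<forall>n. c \<le> max_weight (\<omega> n)"
      then obtain c where c: "0 < c" "\<And>n. c \<le> max_weight (\<omega> n)" by auto
      have "c powr (1 / b) \<le> r n" for n
      proof -
        have "c powr (1 / b) \<le> (r n powr b) powr (1 / b)"
          using c(1) c(2)[of n] M'[of n] True by (intro powr_mono2) auto
        then show ?thesis using True r_pos[of n] by (simp add: powr_powr)
      qed
      with c(1) show ?thesis by (intro exI[of _ "c powr (1 / b)"]) auto
    qed
    with True M' show ?thesis unfolding real by (intro lower_phi_dim_ge) auto
  next
    case False
    have "ereal b \<le> ereal 0" using False by simp
    also have "\<dots> \<le> lower_phi_dim \<Phi> \<mu>"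
      using r_pos less_imp_le[OF max_weight_bounds(2)[OF param]]
      by (intro lower_phi_dim_ge) (auto simp: less_imp_neq[symmetric])
    finally show ?thesis by (simp add: real)
  qed
qed (use M[of 0] in auto)

text \<open>For finite \<alpha>, a bound r \<ge> c gives m \<ge> r^\<alpha> \<ge> c^\<alpha>, so
  both alternatives reduce to a lower bound on the weights.\<close>

lemma upper_phi_dim_le_esssup:
  fixes \<alpha> :: ereal
  assumes m: "\<And>n. ereal (ln (min_weight (\<omega> n)) / ln (r n)) \<le> \<alpha>"
    and c: "(\<exists>c>0. \<forall>n. c \<le> min_weight (\<omega> n)) \<or> (\<exists>c>0. \<forall>n. c \<le> r n)"
  shows "upper_phi_dim \<Phi> \<mu> \<le> \<alpha>"
proof (cases \<alpha>)
  case (real a)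
  have m': "r n powr a \<le> min_weight (\<omega> n)" for n
    using m[of n] log_quotient_le_iff(1)[OF r_pos r_less_1 min_weight_bounds(1)[OF param], of n n a]
    by (simp add: real)
  have "0 < ln (min_weight (\<omega> 0)) / ln (r 0)"
    using min_weight_bounds[OF param[of 0]] r_pos[of 0] r_less_1[of 0] by (simp add: divide_neg_neg)
  then have a: "0 \<le> a" using m[of 0] by (simp add: real)
  have "\<exists>c>0. \<forall>n. c \<le> min_weight (\<omega> n)"
  proof (rule disjE[OF c])
    assume "\<exists>c>0. \<forall>n. c \<le> r n"
    then obtain c where c: "0 < c" "\<And>n. c \<le> r n" by auto
    have "c powr a \<le> min_weight (\<omega> n)" for n
      using m'[of n] powr_mono2[OF a _ c(2)[of n]] c(1) by simp
    with c(1) show ?thesis by (intro exI[of _ "c powr a"]) auto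
  qed
  then show ?thesis unfolding real using upper_phi_dim_le[OF a m'] by auto
qed (use m[of 0] in auto)

lemma neg_ln_D: "- ln (D n) = (\<Sum>k<n. - ln (r k))"
  unfolding diam_prod_def by (subst ln_prod) (auto simp: less_imp_neq[OF r_pos, symmetric] sum_negf)

end

section \<open>Almost sure properties\<close>

text \<open>Each coordinate has law M under the product, and an essential supremum depends only on
  the law.\<close>

lemma esssup_PiM_component:
  fixes f :: "'b \<Rightarrow> ereal"
  assumes M: "prob_space M" and f [measurable]: "f \<in> borel_measurable M"
  shows "esssup (PiM UNIV (\<lambda>_. M)) (\<lambda>\<omega>. f (\<omega> i)) = esssup M f"
proof -
  have distr: "distr (PiM UNIV (\<lambda>_. M)) M (\<lambda>\<omega>. \<omega> i) = M"
    by (rule distr_PiM_component) (auto simp: M)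
  have "(AE \<omega> in PiM UNIV (\<lambda>_. M). f (\<omega> i) \<le> z) \<longleftrightarrow> (AE x in M. f x \<le> z)" for z
    by (subst (2) distr[symmetric], subst AE_distr_iff) auto
  then show ?thesis
    by (subst (1 2) esssup_eq_AE) auto
qed

text \<open>Independence means that the joint law is the product of the laws, and here the joint map
  is the identity.\<close>

lemma indep_vars_PiM_components:
  assumes M: "prob_space M"
  shows "prob_space.indep_vars (PiM UNIV (\<lambda>_. M)) (\<lambda>_. M) (\<lambda>i \<omega>. \<omega> i) UNIV"
proof -
  interpret P: prob_space "PiM UNIV (\<lambda>_. M)" by (rule prob_space_PiM) (rule M)
  show ?thesis
    by (subst P.indep_vars_iff_distr_eq_PiM')
      (simp_all add: distr_PiM_component[of UNIV "\<lambda>_. M", OF M] restrict_UNIV distr_id)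
qed

text \<open>
  For L * B ^ L disjoint windows of length L, each consisting of good coordinates with probability
  q ^ L where q * B >= 1, the probability that none is good is at most
  (1 - q ^ L) ^ (L * B ^ L) <= exp (- L).
\<close>

lemma AE_PiM_windows:
  fixes M :: "'b measure"
  assumes M: "prob_space M" and G: "G \<in> sets M" "0 < measure M G"
  obtains B :: nat where "0 < B"
    "AE \<omega> in PiM UNIV (\<lambda>_::nat. M). \<forall>\<^sub>F L in sequentially.
       \<exists>i\<in>{1..L * B ^ L}. \<forall>k\<in>{i * L..<i * L + L}. \<omega> k \<in> G"
proof -
  define P where "P = PiM UNIV (\<lambda>_::nat. M)"
  interpret M: prob_space M by (rule M)
  interpret P: prob_space P unfolding P_def by (rule prob_space_PiM) (rule M)
  note [measurable] = G(1)
  define q where "q = measure M G"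
  obtain B :: nat where B: "1 / q \<le> real B" using real_arch_simple by blast
  have qB: "1 \<le> q * real B" using B G(2) by (simp add: q_def field_simps)
  have B_pos: "0 < B" using qB by (cases B) auto
  define Bad where "Bad L = {\<omega> \<in> space P. \<forall>i\<in>{1..L * B ^ L}. \<exists>k\<in>{i * L..<i * L + L}. \<omega> k \<notin> G}" for L
  have Bad_meas [measurable]: "Bad L \<in> sets P" for L
    unfolding Bad_def P_def by measurable
  have indep: "P.indep_vars (\<lambda>_. M) (\<lambda>i \<omega>. \<omega> i) UNIV"
    unfolding P_def by (rule indep_vars_PiM_components[OF M])
  have coord: "P.prob ((\<lambda>\<omega>. \<omega> k) -` G \<inter> space P) = q" for k
  proof -
    have "distr P M (\<lambda>\<omega>. \<omega> k) = M"
      unfolding P_def by (rule distr_PiM_component) (auto simp: M)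
    moreover have "P.prob ((\<lambda>\<omega>. \<omega> k) -` G \<inter> space P) = measure (distr P M (\<lambda>\<omega>. \<omega> k)) G"
      by (rule measure_distr[symmetric]) (auto simp: P_def)
    ultimately show ?thesis by (simp add: q_def)
  qed
  have Bad_prob: "P.prob (Bad L) \<le> exp (- real L)" for L
  \<comment> \<open>At L = 0 the bound is exp 0 = 1. For L > 0 the windows and the set of window
    indices are nonempty.\<close>
  proof (cases "L = 0")
    case False
    \<comment> \<open>The windows are disjoint, since \<open>k div L\<close> recovers the index of
      the window containing k. Hence the restrictions of \<omega> to them are independent.\<close>
    define K where "K i = {i * L..<i * L + L}" for i
    define Y where "Y i \<omega> = restrict \<omega> (K i)" for i and \<omega> :: "nat \<Rightarrow> 'b"
    define A where "A i = space (PiM (K i) (\<lambda>_. M)) - PiE (K i) (\<lambda>_. G)" for i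
    have K: "finite (K i)" "K i \<noteq> {}" "card (K i) = L" for i
      using False by (auto simp: K_def)
    have "disjoint_family_on K {1..L * B ^ L}"
      unfolding disjoint_family_on_def
    proof safe
      fix i j k assume "i \<noteq> j" "k \<in> K i" "k \<in> K j"
      then have "k div L = i" "k div L = j"
        by (auto simp: K_def intro!: div_nat_eqI simp: algebra_simps)
      with \<open>i \<noteq> j\<close> show "k \<in> {}" by simp
    qed
    then have indep_Y: "P.indep_vars (\<lambda>i. PiM (K i) (\<lambda>_. M)) Y {1..L * B ^ L}"
      unfolding Y_def by (rule P.indep_vars_restrict[OF indep, rotated]) simp
    have A: "A i \<in> sets (PiM (K i) (\<lambda>_. M))" for i
      unfolding A_def using K by (intro sets.compl_sets sets_PiM_I_finite) auto
    have Y_A: "P.prob (Y i -` A i \<inter> space P) = 1 - q ^ L" for i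
    proof -
      have "Y i -` A i \<inter> space P = space P - (\<Inter>k\<in>K i. (\<lambda>\<omega>. \<omega> k) -` G \<inter> space P)"
        using K(2)[of i] by (auto simp: Y_def A_def P_def space_PiM PiE_iff)
      moreover have "P.prob (\<Inter>k\<in>K i. (\<lambda>\<omega>. \<omega> k) -` G \<inter> space P) = q ^ L"
        using K by (subst P.indep_varsD[OF indep]) (auto simp: coord)
      moreover have "(\<Inter>k\<in>K i. (\<lambda>\<omega>. \<omega> k) -` G \<inter> space P) \<in> sets P"
        using K[of i] by (intro sets.finite_INT) (auto simp: P_def)
      ultimately show ?thesis by (simp add: P.prob_compl)
    qed
    have N: "{1..L * B ^ L} \<noteq> {}" using False B_pos by auto
    have "Bad L = (\<Inter>i\<in>{1..L * B ^ L}. Y i -` A i \<inter> space P)"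
      using N by (auto simp: Bad_def Y_def A_def P_def space_PiM PiE_iff K_def[symmetric])
    then have "P.prob (Bad L) = (\<Prod>i\<in>{1..L * B ^ L}. 1 - q ^ L)"
      using P.indep_varsD_finite[OF indep_Y N _ A] Y_A by simp
    also have "\<dots> = (1 - q ^ L) ^ (L * B ^ L)" by simp
    also have "\<dots> \<le> exp (- (q ^ L)) ^ (L * B ^ L)"
    proof (rule power_mono)
      show "1 - q ^ L \<le> exp (- (q ^ L))" using exp_ge_add_one_self[of "- (q ^ L)"] by simp
      show "0 \<le> 1 - q ^ L" by (simp add: q_def power_le_one)
    qed
    also have "\<dots> = exp (- (real L * (q * real B) ^ L))"
      by (simp add: exp_of_nat_mult[symmetric] power_mult_distrib algebra_simps)
    also have "\<dots> \<le> exp (- real L)"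
    proof -
      have "real L * 1 \<le> real L * (q * real B) ^ L"
        by (intro mult_left_mono one_le_power qB) simp
      then show ?thesis by simp
    qed
    finally show ?thesis .
  qed simp
  \<comment> \<open>The bad events have summable probabilities, so by Borel-Cantelli almost surely
    all but finitely many L have a good window.\<close>
  have "summable (\<lambda>L. exp (- 1 :: real) ^ L)" by (rule summable_geometric) simp
  then have "summable (\<lambda>L. exp (- real L))"
    by (simp add: exp_of_nat_mult[symmetric])
  then have "summable (\<lambda>L. P.prob (Bad L))"
    by (rule summable_comparison_test'[where N = 0]) (use Bad_prob in simp)
  then have "AE \<omega> in P. \<forall>\<^sub>F L in sequentially. \<omega> \<in> space P - Bad L"
    by (intro borel_cantelli_AE1) (auto simp: P.emeasure_eq_measure)
  then have "AE \<omega> in P. \<forall>\<^sub>F L in sequentially.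
       \<exists>i\<in>{1..L * B ^ L}. \<forall>k\<in>{i * L..<i * L + L}. \<omega> k \<in> G"
    by eventually_elim (auto elim!: eventually_mono simp: Bad_def)
  with B_pos that show ?thesis unfolding P_def by blast
qed

text \<open>By Markov's inequality Z(\<omega> n) \<ge> (n + 1)^2 has probability at most E Z / (n +
  1)^2, so Borel-Cantelli leaves finitely many exceptions. Polynomial growth is all that is wanted,
  as only log |log (D n)| matters.\<close>

lemma AE_PiM_partial_sums_bounded:
  fixes Z :: "'b \<Rightarrow> real"
  assumes M: "prob_space M" and Z: "integrable M Z" "\<And>x. x \<in> space M \<Longrightarrow> 0 \<le> Z x"
  shows "AE \<omega> in PiM UNIV (\<lambda>_::nat. M). \<exists>H. \<forall>n. (\<Sum>k<n. Z (\<omega> k)) \<le> H * (real n + 1) ^ 3"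
proof -
  define P where "P = PiM UNIV (\<lambda>_::nat. M)"
  interpret M: prob_space M by (rule M)
  interpret P: prob_space P unfolding P_def by (rule prob_space_PiM) (rule M)
  have [measurable]: "Z \<in> borel_measurable M" using Z(1) by simp
  define A where "A n = {\<omega> \<in> space P. (real n + 1)\<^sup>2 \<le> Z (\<omega> n)}" for n
  have A_meas: "A n \<in> sets P" for n unfolding A_def P_def by measurable
  have "P.prob (A n) \<le> (\<integral>x. Z x \<partial>M) / (real n + 1)\<^sup>2" for n
  proof -
    have "distr P M (\<lambda>\<omega>. \<omega> n) = M"
      unfolding P_def by (rule distr_PiM_component) (auto simp: M)
    moreover have "measure (distr P M (\<lambda>\<omega>. \<omega> n)) {x \<in> space M. (real n + 1)\<^sup>2 \<le> Z x} = P.prob (A n)"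
      by (subst measure_distr) (auto simp: P_def A_def space_PiM intro!: arg_cong[where f = "measure _"])
    ultimately have "P.prob (A n) = M.prob {x \<in> space M. (real n + 1)\<^sup>2 \<le> Z x}" by simp
    also have "\<dots> \<le> (\<integral>x. Z x \<partial>M) / (real n + 1)\<^sup>2"
      using Z by (intro integral_Markov_inequality_measure[where A = "space M" and u = Z, simplified]) auto
    finally show ?thesis .
  qed
  moreover have "summable (\<lambda>n. (\<integral>x. Z x \<partial>M) / (real n + 1)\<^sup>2)"
  proof -
    have "summable (\<lambda>n. inverse (real (Suc n) ^ 2))"
      by (subst summable_Suc_iff) (rule inverse_power_summable, simp)
    from summable_mult[OF this, of "\<integral>x. Z x \<partial>M"] show ?thesis
      by (simp add: divide_inverse add.commute)
  qed
  ultimately have "summable (\<lambda>n. P.prob (A n))"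
    by (intro summable_comparison_test'[where N = 0 and f = "\<lambda>n. P.prob (A n)"
          and g = "\<lambda>n. (\<integral>x. Z x \<partial>M) / (real n + 1)\<^sup>2"]) simp_all
  then have "AE \<omega> in P. \<forall>\<^sub>F n in sequentially. \<omega> \<in> space P - A n"
    using A_meas by (intro borel_cantelli_AE1) (auto simp: P.emeasure_eq_measure)
  then have "AE \<omega> in P. \<exists>H. \<forall>n. (\<Sum>k<n. Z (\<omega> k)) \<le> H * (real n + 1) ^ 3"
    using AE_space
  proof eventually_elim
    case (elim \<omega>)
    have Z_nonneg: "0 \<le> Z (\<omega> k)" for k
      using elim(2) by (intro Z(2)) (auto simp: P_def space_PiM)
    obtain N where N: "\<And>n. N \<le> n \<Longrightarrow> Z (\<omega> n) < (real n + 1)\<^sup>2"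
      using elim by (auto simp: eventually_sequentially A_def not_le)
    \<comment> \<open>The sum of the first N values takes care of the finitely many exceptional
      indices.\<close>
    define H where "H = 1 + (\<Sum>k<N. Z (\<omega> k))"
    have H: "1 \<le> H" unfolding H_def using Z_nonneg by (simp add: sum_nonneg)
    have Z_le: "Z (\<omega> k) \<le> H * (real k + 1)\<^sup>2" for k
    proof (cases "k < N")
      case True
      have "Z (\<omega> k) \<le> (\<Sum>k<N. Z (\<omega> k))"
        using True Z_nonneg by (intro member_le_sum) auto
      also have "\<dots> \<le> H * 1" by (simp add: H_def)
      also have "\<dots> \<le> H * (real k + 1)\<^sup>2"
        using H by (intro mult_left_mono one_le_power) auto
      finally show ?thesis .
    next
      case False
      then have "Z (\<omega> k) \<le> 1 * (real k + 1)\<^sup>2" using N[of k] by simp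
      also have "\<dots> \<le> H * (real k + 1)\<^sup>2" using H by (intro mult_right_mono) auto
      finally show ?thesis .
    qed
    show ?case
    proof (intro exI[of _ H] allI)
      fix n
      have "(\<Sum>k<n. Z (\<omega> k)) \<le> (\<Sum>k<n. H * (real n + 1)\<^sup>2)"
      proof (rule sum_mono)
        fix k assume "k \<in> {..<n}"
        then have "H * (real k + 1)\<^sup>2 \<le> H * (real n + 1)\<^sup>2"
          using H by (intro mult_left_mono power_mono) auto
        with Z_le[of k] show "Z (\<omega> k) \<le> H * (real n + 1)\<^sup>2" by simp
      qed
      also have "\<dots> = real n * (H * (real n + 1)\<^sup>2)" by simp
      also have "\<dots> \<le> (real n + 1) * (H * (real n + 1)\<^sup>2)"
        using H by (intro mult_right_mono) auto
      also have "\<dots> = H * (real n + 1) ^ 3" by (simp add: power2_eq_square power3_eq_cube)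
      finally show "(\<Sum>k<n. Z (\<omega> k)) \<le> H * (real n + 1) ^ 3" .
    qed
  qed
  then show ?thesis unfolding P_def .
qed

section \<open>Measurability and essential bounds of the coordinates\<close>

lemma ratio_measurable: "ratio \<in> borel_measurable borel"
  unfolding ratio_def[abs_def] by (intro borel_measurable_continuous_onI continuous_intros)

lemma weight_measurable: "(\<lambda>a. weight a j) \<in> borel_measurable borel"
proof -
  have "continuous_on UNIV (\<lambda>a::moran_param. snd (snd a))" by (intro continuous_intros)
  then show ?thesis
    unfolding weight_def
    by (intro borel_measurable_continuous_onI) (rule continuous_on_product_then_coordinatewise)
qed

lemma children_count_measurable: "children_count \<in> measurable borel (count_space UNIV)"
proof -
  have "children_count \<in> borel_measurable borel"
    unfolding children_count_def[abs_def] by (intro borel_measurable_continuous_onI continuous_intros)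
  then show ?thesis by (simp only: measurable_cong_sets[OF refl sets_borel_eq_count_space])
qed

text \<open>The number of weights varies with the parameter; on each of the countably many values of
  \<open>children_count\<close> this is a minimum over a fixed finite family.\<close>

lemma min_weight_measurable: "min_weight \<in> borel_measurable borel"
  unfolding min_weight_def[abs_def]
  by (rule measurable_compose_countable[OF _ children_count_measurable])
    (intro borel_measurable_Min weight_measurable, simp)

lemma max_weight_measurable: "max_weight \<in> borel_measurable borel"
  unfolding max_weight_def[abs_def]
  by (rule measurable_compose_countable[OF _ children_count_measurable])
    (intro borel_measurable_Max weight_measurable, simp)

lemma essinf_PiM_component:
  fixes f :: "'b \<Rightarrow> ereal"
  assumes "prob_space M" "f \<in> borel_measurable M"
  shows "essinf (PiM UNIV (\<lambda>_. M)) (\<lambda>\<omega>. f (\<omega> i)) = essinf M f"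
  unfolding essinf_def using assms by (subst esssup_PiM_component[where f = "\<lambda>x. - f x"]) auto

lemma essinf_AE: "AE x in M. essinf M f \<le> f x"
  using esssup_AE[of "\<lambda>x. - f x" M] by eventually_elim (simp add: essinf_def ereal_uminus_le_reorder)

lemma AE_PiM_all_components:
  assumes "prob_space M" "AE x in M. Q x"
  shows "AE \<omega> in PiM UNIV (\<lambda>_::nat. M). \<forall>n. Q (\<omega> n)"
  unfolding AE_all_countable
proof
  fix n show "AE \<omega> in PiM UNIV (\<lambda>_::nat. M). Q (\<omega> n)"
    by (rule AE_PiM_component[where M = "\<lambda>_. M"]) (use assms in auto)
qed

section \<open>Dimensions of random Moran measures\<close>

theorem theorem3:
  fixes I0 :: "'a::euclidean_space set"
    and \<tau> :: real
    and \<rho> :: "nat \<Rightarrow> real"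
    and \<pi> :: "moran_param measure"
    and P :: "(nat \<Rightarrow> moran_param) measure"
    and I :: "(nat \<Rightarrow> moran_param) \<Rightarrow> nat list \<Rightarrow> 'a set"
    and \<mu> :: "(nat \<Rightarrow> moran_param) \<Rightarrow> 'a measure"
    and \<alpha> \<beta> :: ereal
  assumes "compact I0" and "diameter I0 = 1" and "interior I0 \<noteq> {}"
    and "0 < \<tau>" and "\<tau> < 1"
    and "\<And>t. 1 \<le> t \<Longrightarrow> 0 < \<rho> t \<and> \<rho> t \<le> 1/2"
    and "\<And>t r. 1 \<le> t \<Longrightarrow> 0 < r \<Longrightarrow> r \<le> \<rho> t \<Longrightarrow> \<exists>J. separated_similarities \<tau> r I0 t J"
    and "prob_space \<pi>" and "sets \<pi> = sets (restrict_space borel (Omega0 \<rho>))"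
    and "P = PiM UNIV (\<lambda>_. \<pi>)"
    and "\<And>\<omega>. \<omega> \<in> space P \<Longrightarrow> moran_construction \<tau> I0 \<omega> (I \<omega>)"
    and "\<And>\<omega>. \<omega> \<in> space P \<Longrightarrow> moran_measure \<omega> (I \<omega>) (\<mu> \<omega>)"
    and "\<exists>A0>0. \<forall>l. \<bar>l\<bar> \<le> A0 \<longrightarrow> integrable P (\<lambda>\<omega>. exp (l * - ln (ratio (\<omega> 0))))"
    and "\<alpha> = esssup P (\<lambda>\<omega>. ereal (ln (min_weight (\<omega> 0)) / ln (ratio (\<omega> 0))))"
    and "\<beta> = essinf P (\<lambda>\<omega>. ereal (ln (max_weight (\<omega> 0)) / ln (ratio (\<omega> 0))))"
  shows "\<exists>\<Gamma>\<in>sets P. measure P \<Gamma> = 1 \<and>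
    (\<forall>\<Phi>. small_dimension_function \<Phi> \<longrightarrow>
       (\<forall>\<omega>\<in>\<Gamma>. lower_phi_dim \<Phi> (\<mu> \<omega>) \<le> \<beta> \<and> upper_phi_dim \<Phi> (\<mu> \<omega>) \<ge> \<alpha>)) \<and>
    (essinf P (\<lambda>\<omega>. ereal (max_weight (\<omega> 0))) > 0 \<or> essinf P (\<lambda>\<omega>. ereal (ratio (\<omega> 0))) > 0 \<longrightarrow>
       (\<forall>\<Phi>. dimension_function \<Phi> \<longrightarrow> (\<forall>\<omega>\<in>\<Gamma>. lower_phi_dim \<Phi> (\<mu> \<omega>) \<ge> \<beta>))) \<and>
    (essinf P (\<lambda>\<omega>. ereal (min_weight (\<omega> 0))) > 0 \<or> essinf P (\<lambda>\<omega>. ereal (ratio (\<omega> 0))) > 0 \<longrightarrow>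
       (\<forall>\<Phi>. dimension_function \<Phi> \<longrightarrow> (\<forall>\<omega>\<in>\<Gamma>. upper_phi_dim \<Phi> (\<mu> \<omega>) \<le> \<alpha>)))"
proof -

  \<comment> \<open>Reduction to the law of one coordinate\<close>
  note \<rho> = assms(6) and \<pi> = assms(8) and sets_\<pi> = assms(9) and P = assms(10)
  interpret \<pi>: prob_space \<pi> by (rule \<pi>)
  interpret P: prob_space P unfolding P by (rule prob_space_PiM) (rule \<pi>)
  have space_\<pi>: "space \<pi> = Omega0 \<rho>"
    using sets_eq_imp_space_eq[OF sets_\<pi>] by (simp add: space_restrict_space)
  have ratio_bounds: "0 < ratio x" "ratio x < 1" if "x \<in> space \<pi>" for x
    using Omega0_cases[of x \<rho>] that \<rho>[of "children_count x"] by (auto simp: space_\<pi>)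
  have meas: "h \<in> borel_measurable \<pi>" if "h \<in> borel_measurable borel" for h :: "moran_param \<Rightarrow> real"
    unfolding measurable_cong_sets[OF sets_\<pi> refl] by (rule measurable_restrict_space1[OF that])
  note [measurable] = meas[OF ratio_measurable] meas[OF min_weight_measurable] meas[OF max_weight_measurable]

  define f where "f x = ereal (ln (min_weight x) / ln (ratio x))" for x
  define g where "g x = ereal (ln (max_weight x) / ln (ratio x))" for x
  have [measurable]: "f \<in> borel_measurable \<pi>" "g \<in> borel_measurable \<pi>"
    unfolding f_def g_def by measurable
  have \<alpha>: "\<alpha> = esssup \<pi> f"
    unfolding assms(14) P f_def[symmetric] by (intro esssup_PiM_component \<pi>) measurable
  have \<beta>: "\<beta> = essinf \<pi> g"
    unfolding assms(15) P g_def[symmetric] by (intro essinf_PiM_component \<pi>) measurable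
  have essinf_P: "essinf P (\<lambda>\<omega>. ereal (h (\<omega> 0))) = essinf \<pi> (\<lambda>x. ereal (h x))"
    if "h \<in> borel_measurable \<pi>" for h
    unfolding P using \<pi> that by (intro essinf_PiM_component) auto

  \<comment> \<open>\<open>lim h \<omega>\<close> says that every coordinate respects the essential
    infimum of h; when this infimum is positive, it yields one lower bound c > 0 for all
    coordinates.\<close>
  define lim where "lim h \<omega> \<longleftrightarrow> (\<forall>n. essinf \<pi> (\<lambda>x. ereal (h x)) \<le> ereal (h (\<omega> n)))"
    for h :: "moran_param \<Rightarrow> real" and \<omega> :: "nat \<Rightarrow> moran_param"
  have lim_AE: "AE \<omega> in P. lim h \<omega>" for h
    unfolding P lim_def by (intro AE_PiM_all_components \<pi> essinf_AE)
  have lim_pos: "\<exists>c>0. \<forall>n. c \<le> h (\<omega> n)"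
    if h: "lim h \<omega>" "0 < essinf P (\<lambda>\<omega>. ereal (h (\<omega> 0)))" "h \<in> borel_measurable \<pi>" for h \<omega>
  proof -
    obtain c where c: "0 < ereal c" "ereal c < essinf \<pi> (\<lambda>x. ereal (h x))"
      using ereal_dense2[OF h(2)] unfolding essinf_P[OF h(3)] by blast
    have "c \<le> h (\<omega> n)" for n
      using less_le_trans[OF c(2), of "ereal (h (\<omega> n))"] h(1) by (simp add: lim_def)
    with c(1) show ?thesis by auto
  qed

  \<comment> \<open>Windows of nearly extremal coordinates\<close>
  define windows where "windows G \<omega> \<longleftrightarrow> (\<exists>B>0. \<forall>\<^sub>F L in sequentially.
      \<exists>i\<in>{1..L * B ^ L}. \<forall>k\<in>{i * L..<i * L + L}. \<omega> k \<in> G)"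
    for G :: "moran_param set" and \<omega> :: "nat \<Rightarrow> moran_param"
  have windows_AE: "AE \<omega> in P. windows G \<omega>" if "G \<in> sets \<pi>" "0 < emeasure \<pi> G" for G
  proof -
    have "0 < measure \<pi> G" using that by (simp add: \<pi>.emeasure_eq_measure)
    from AE_PiM_windows[OF \<pi> that(1) this] obtain B where "0 < B"
      "AE \<omega> in P. \<forall>\<^sub>F L in sequentially. \<exists>i\<in>{1..L * B ^ L}. \<forall>k\<in>{i * L..<i * L + L}. \<omega> k \<in> G"
      unfolding P by blast
    then show ?thesis unfolding windows_def by (auto elim!: eventually_mono)
  qed
  \<comment> \<open>By definition of the essential bounds, \<open>F q\<close> has positive
    probability for q < \<alpha>, and \<open>G q\<close> for q > \<beta>.\<close>
  define F where "F q = {x \<in> space \<pi>. ereal (of_rat q) < f x}" for q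
  define G where "G q = {x \<in> space \<pi>. g x < ereal (of_rat q)}" for q
  have F_AE: "AE \<omega> in P. \<forall>q. ereal (of_rat q) < \<alpha> \<longrightarrow> windows (F q) \<omega>"
    unfolding AE_all_countable
  proof
    fix q :: rat
    show "AE \<omega> in P. ereal (of_rat q) < \<alpha> \<longrightarrow> windows (F q) \<omega>"
    proof (cases "ereal (of_rat q) < \<alpha>")
      case True
      then have "0 < emeasure \<pi> (F q)"
        unfolding F_def \<alpha> by (intro esssup_pos_measure) auto
      moreover have "F q \<in> sets \<pi>" unfolding F_def by measurable
      ultimately show ?thesis using windows_AE by auto
    qed simp
  qed
  have G_AE: "AE \<omega> in P. \<forall>q. \<beta> < ereal (of_rat q) \<longrightarrow> windows (G q) \<omega>"
    unfolding AE_all_countable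
  proof
    fix q :: rat
    show "AE \<omega> in P. \<beta> < ereal (of_rat q) \<longrightarrow> windows (G q) \<omega>"
    proof (cases "\<beta> < ereal (of_rat q)")
      case True
      then have "- ereal (of_rat q) < esssup \<pi> (\<lambda>x. - g x)"
        unfolding \<beta> essinf_def by (simp add: ereal_uminus_less_reorder)
      then have "0 < emeasure \<pi> {x \<in> space \<pi>. - ereal (of_rat q) < - g x}"
        by (intro esssup_pos_measure) auto
      also have "{x \<in> space \<pi>. - ereal (of_rat q) < - g x} = G q"
        unfolding G_def by (simp only: ereal_minus_less_minus)
      finally have "0 < emeasure \<pi> (G q)" .
      moreover have "G q \<in> sets \<pi>" unfolding G_def by measurable
      ultimately show ?thesis using windows_AE by auto
    qed simp
  qed

  \<comment> \<open>Growth of the logarithms of the diameters\<close>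
  have int_Z: "integrable \<pi> (\<lambda>x. - ln (ratio x))"
  proof -
    \<comment> \<open>One exponential moment with l > 0 suffices: l Z is nonnegative and at most exp
      (l Z).\<close>
    obtain l where l: "0 < l" "integrable P (\<lambda>\<omega>. exp (l * - ln (ratio (\<omega> 0))))"
      using assms(13) by (metis abs_of_pos order_refl)
    have distr: "distr P \<pi> (\<lambda>\<omega>. \<omega> 0) = \<pi>"
      unfolding P by (rule distr_PiM_component) (auto simp: \<pi>)
    have [measurable]: "(\<lambda>\<omega>. \<omega> 0) \<in> measurable P \<pi>" unfolding P by measurable
    have "integrable (distr P \<pi> (\<lambda>\<omega>. \<omega> 0)) (\<lambda>x. exp (l * - ln (ratio x)))"
      by (subst integrable_distr_eq) (use l(2) in auto)
    then have "integrable \<pi> (\<lambda>x. exp (l * - ln (ratio x)))"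
      by (simp add: distr)
    then have "integrable \<pi> (\<lambda>x. exp (l * - ln (ratio x)) / l)" by simp
    then show ?thesis
    proof (rule Bochner_Integration.integrable_bound)
      show "AE x in \<pi>. norm (- ln (ratio x)) \<le> norm (exp (l * - ln (ratio x)) / l)"
      proof (rule AE_I2)
        fix x assume "x \<in> space \<pi>"
        then have "0 \<le> - ln (ratio x)" using ratio_bounds[of x] by simp
        moreover have "l * - ln (ratio x) \<le> exp (l * - ln (ratio x))"
          using exp_ge_add_one_self[of "l * - ln (ratio x)"] by linarith
        ultimately show "norm (- ln (ratio x)) \<le> norm (exp (l * - ln (ratio x)) / l)"
          using l(1) by (simp add: field_simps)
      qed
    qed measurable
  qed
  have growth_AE: "AE \<omega> in P. \<exists>H. \<forall>n. (\<Sum>k<n. - ln (ratio (\<omega> k))) \<le> H * (real n + 1) ^ 3"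
    unfolding P by (rule AE_PiM_partial_sums_bounded[OF \<pi> int_Z]) (use ratio_bounds in force)

  \<comment> \<open>Typical outcomes\<close>
  have f_AE: "AE \<omega> in P. \<forall>n. f (\<omega> n) \<le> \<alpha>" and g_AE: "AE \<omega> in P. \<forall>n. \<beta> \<le> g (\<omega> n)"
    unfolding \<alpha> \<beta> P by (intro AE_PiM_all_components \<pi> esssup_AE essinf_AE)+

  \<comment> \<open>None of these conditions mentions \<Phi>, so a single set \<Gamma> serves all
    dimension functions, of which there are uncountably many.\<close>
  define typical where "typical \<omega> \<longleftrightarrow>
      (\<exists>H. \<forall>n. (\<Sum>k<n. - ln (ratio (\<omega> k))) \<le> H * (real n + 1) ^ 3) \<and>
      (\<forall>n. f (\<omega> n) \<le> \<alpha>) \<and> (\<forall>n. \<beta> \<le> g (\<omega> n)) \<and>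
      (\<forall>q. ereal (of_rat q) < \<alpha> \<longrightarrow> windows (F q) \<omega>) \<and>
      (\<forall>q. \<beta> < ereal (of_rat q) \<longrightarrow> windows (G q) \<omega>) \<and>
      lim ratio \<omega> \<and> lim min_weight \<omega> \<and> lim max_weight \<omega>" for \<omega>
  have "AE \<omega> in P. typical \<omega>"
    unfolding typical_def
    using growth_AE f_AE g_AE F_AE G_AE lim_AE[of ratio] lim_AE[of min_weight] lim_AE[of max_weight]
    by eventually_elim blast
  \<comment> \<open>\<Gamma> will be the complement of a measurable null set containing all outcomes
    that are not typical.\<close>
  then obtain N where N: "{\<omega> \<in> space P. \<not> typical \<omega>} \<subseteq> N" "emeasure P N = 0" "N \<in> sets P"
    by (rule AE_E)
  define \<Gamma> where "\<Gamma> = space P - N"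
  have \<Gamma>: "\<omega> \<in> space P" "typical \<omega>" if "\<omega> \<in> \<Gamma>" for \<omega>
    using that N(1) by (auto simp: \<Gamma>_def)
  have realisation: "moran_realisation \<tau> \<rho> I0 \<omega> (I \<omega>) (\<mu> \<omega>)" if "\<omega> \<in> \<Gamma>" for \<omega>
  proof
    show "\<omega> n \<in> Omega0 \<rho>" for n
      using \<Gamma>(1)[OF that] by (auto simp: P space_PiM space_\<pi>)
  qed (use assms \<Gamma>(1)[OF that] in auto)

  \<comment> \<open>The three claims for a typical outcome\<close>
  show ?thesis
  proof (intro bexI[of _ \<Gamma>] conjI allI impI ballI)
    show "\<Gamma> \<in> sets P" using N(3) by (auto simp: \<Gamma>_def)
    show "measure P \<Gamma> = 1" using P.prob_compl[OF N(3)] N(2) by (simp add: \<Gamma>_def measure_eq_emeasure_eq_ennreal[of 0])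
  next
    fix \<Phi> \<omega> assume \<Phi>: "small_dimension_function \<Phi>" and \<omega>: "\<omega> \<in> \<Gamma>"
    interpret moran_realisation \<tau> \<rho> I0 \<omega> "I \<omega>" "\<mu> \<omega>" by (rule realisation[OF \<omega>])
    from \<Gamma>(2)[OF \<omega>] obtain H where growth: "\<And>n. - ln (D n) \<le> H * (real n + 1) ^ 3"
      unfolding typical_def neg_ln_D by blast
    show "lower_phi_dim \<Phi> (\<mu> \<omega>) \<le> \<beta>"
    \<comment> \<open>A failure leaves a rational q strictly between \<beta> and the dimension;
      windows in \<open>G q\<close> then force the dimension to be at most q.\<close>
    proof (rule ccontr)
      assume "\<not> lower_phi_dim \<Phi> (\<mu> \<omega>) \<le> \<beta>"
      then obtain q where q: "\<beta> < ereal (of_rat q)" "ereal (of_rat q) < lower_phi_dim \<Phi> (\<mu> \<omega>)"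
        using rat_dense_ereal[of \<beta> "lower_phi_dim \<Phi> (\<mu> \<omega>)"] by (auto simp: not_le)
      then obtain B where B: "0 < B" "\<forall>\<^sub>F L in sequentially.
          \<exists>i\<in>{1..L * B ^ L}. \<forall>k\<in>{i * L..<i * L + L}. \<omega> k \<in> G q"
        using \<Gamma>(2)[OF \<omega>] unfolding typical_def windows_def by blast
      have "ratio (\<omega> k) powr of_rat q \<le> max_weight (\<omega> k)" if "\<omega> k \<in> G q" for k
        using that
        by (intro log_quotient_le_iff(1)[OF r_pos[of k] r_less_1 max_weight_bounds(1)[OF param[of k]], THEN iffD1])
          (simp add: G_def g_def less_imp_le)
      then have "\<forall>\<^sub>F L in sequentially. \<exists>i\<in>{1..L * B ^ L}. \<forall>k\<in>{i * L..<i * L + L}.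
          ratio (\<omega> k) powr of_rat q \<le> max_weight (\<omega> k)"
        using B(2) by (auto elim!: eventually_mono)
      from lower_phi_dim_le[OF \<Phi> growth B(1) this] q(2) show False by simp
    qed
    show "\<alpha> \<le> upper_phi_dim \<Phi> (\<mu> \<omega>)"
    \<comment> \<open>Now q lies strictly between the dimension and \<alpha>, and windows in
      \<open>F q\<close> force the dimension to be at least q.\<close>
    proof (rule ccontr)
      assume "\<not> \<alpha> \<le> upper_phi_dim \<Phi> (\<mu> \<omega>)"
      then obtain q where q: "ereal (of_rat q) < \<alpha>" "upper_phi_dim \<Phi> (\<mu> \<omega>) < ereal (of_rat q)"
        using rat_dense_ereal[of "upper_phi_dim \<Phi> (\<mu> \<omega>)" \<alpha>] by (auto simp: not_le)
      then obtain B where B: "0 < B" "\<forall>\<^sub>F L in sequentially.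
          \<exists>i\<in>{1..L * B ^ L}. \<forall>k\<in>{i * L..<i * L + L}. \<omega> k \<in> F q"
        using \<Gamma>(2)[OF \<omega>] unfolding typical_def windows_def by blast
      have "min_weight (\<omega> k) \<le> ratio (\<omega> k) powr of_rat q" if "\<omega> k \<in> F q" for k
        using that
        by (intro log_quotient_le_iff(2)[OF r_pos[of k] r_less_1 min_weight_bounds(1)[OF param[of k]], THEN iffD1])
          (simp add: F_def f_def less_imp_le)
      then have "\<forall>\<^sub>F L in sequentially. \<exists>i\<in>{1..L * B ^ L}. \<forall>k\<in>{i * L..<i * L + L}.
          min_weight (\<omega> k) \<le> ratio (\<omega> k) powr of_rat q"
        using B(2) by (auto elim!: eventually_mono)
      from upper_phi_dim_ge[OF \<Phi> growth B(1) this] q(2) show False by simp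
    qed
  next
    fix \<Phi> \<omega>
    assume pos: "0 < essinf P (\<lambda>\<omega>. ereal (max_weight (\<omega> 0))) \<or> 0 < essinf P (\<lambda>\<omega>. ereal (ratio (\<omega> 0)))"
      and \<omega>: "\<omega> \<in> \<Gamma>"
    interpret moran_realisation \<tau> \<rho> I0 \<omega> "I \<omega>" "\<mu> \<omega>" by (rule realisation[OF \<omega>])
    have "lim ratio \<omega>" "lim max_weight \<omega>" and g: "\<And>n. \<beta> \<le> g (\<omega> n)"
      using \<Gamma>(2)[OF \<omega>] unfolding typical_def by blast+
    then have "(\<exists>c>0. \<forall>n. c \<le> max_weight (\<omega> n)) \<or> (\<exists>c>0. \<forall>n. c \<le> ratio (\<omega> n))"
      using pos lim_pos[of max_weight \<omega>] lim_pos[of ratio \<omega>] by auto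
    then show "\<beta> \<le> lower_phi_dim \<Phi> (\<mu> \<omega>)"
      by (intro lower_phi_dim_ge_essinf g[unfolded g_def])
  next
    fix \<Phi> \<omega>
    assume pos: "0 < essinf P (\<lambda>\<omega>. ereal (min_weight (\<omega> 0))) \<or> 0 < essinf P (\<lambda>\<omega>. ereal (ratio (\<omega> 0)))"
      and \<omega>: "\<omega> \<in> \<Gamma>"
    interpret moran_realisation \<tau> \<rho> I0 \<omega> "I \<omega>" "\<mu> \<omega>" by (rule realisation[OF \<omega>])
    have "lim ratio \<omega>" "lim min_weight \<omega>" and f: "\<And>n. f (\<omega> n) \<le> \<alpha>"
      using \<Gamma>(2)[OF \<omega>] unfolding typical_def by blast+
    then have "(\<exists>c>0. \<forall>n. c \<le> min_weight (\<omega> n)) \<or> (\<exists>c>0. \<forall>n. c \<le> ratio (\<omega> n))"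
      using pos lim_pos[of min_weight \<omega>] lim_pos[of ratio \<omega>] by auto
    then show "upper_phi_dim \<Phi> (\<mu> \<omega>) \<le> \<alpha>"
      by (intro upper_phi_dim_le_esssup f[unfolded f_def])
  qed
qed

end
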